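(* Let $n_1, n_2, \ldots, n_t$ be a sequence of sufficiently large integers, of which $t_e$ are even and $t_o$ are odd. Let $c=82\times 35^{2^{t_o}-2}\times 81^{t_e}$ and $n=\max(n_1,\dots,n_t)$, and suppose that for all $i$ we have $n_i\geq 2\lceil \log (nc) \rceil+2$. Then $$\hat{R}(C_{n_1},\ldots,C_{n_t})\leq (\ln c+1)\,c^2\, n.$$
   Context: $C_k$ denotes the cycle on $k$ vertices. For graphs $G_1,\ldots,G_k$, the size-Ramsey number $\hat{R}(G_1,\ldots,G_k)$ is the smallest integer $m$ for which there exists a graph $H$ with $m$ edges such that for every coloring of the edges of $H$ with colors $1,\ldots,k$ there is, for some $i$, a copy of $G_i$ in $H$ all of whose edges have color $i$. $\log$ denotes the logarithm to base $2$ and $\ln$ the natural logarithm. *)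

theory Defs
  imports Complex_Main
begin

definition is_graph :: "nat set set \<Rightarrow> bool" where
  "is_graph E \<longleftrightarrow> finite E \<and> (\<forall>e\<in>E. card e = 2)"

definition has_cycle :: "nat \<Rightarrow> nat set set \<Rightarrow> bool" where
  "has_cycle k F \<longleftrightarrow> 3 \<le> k \<and>
     (\<exists>f :: nat \<Rightarrow> nat. inj_on f {0..<k} \<and>
        (\<forall>i<k. {f i, f (Suc i mod k)} \<in> F))"

definition arrows_cycles :: "nat set set \<Rightarrow> nat list \<Rightarrow> bool" where
  "arrows_cycles E ns \<longleftrightarrow>
     (\<forall>col :: nat set \<Rightarrow> nat. (\<forall>e\<in>E. col e < length ns) \<longrightarrow>
        (\<exists>i<length ns. has_cycle (ns ! i) {e\<in>E. col e = i}))"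

definition size_ramsey_cycles :: "nat list \<Rightarrow> nat" where
  "size_ramsey_cycles ns =
     (LEAST m. \<exists>E. is_graph E \<and> card E = m \<and> arrows_cycles E ns)"

end

theory Submission
  imports Defs "HOL-Library.Disjoint_Sets"
begin

text \<open>
  A greedy hitting argument gives a graph on a constant multiple of \<open>n\<close> vertices, with the stated
  number of edges, in which any two disjoint \<open>n\<close>-sets are joined by an edge. Given a colouring,
  colours are eliminated one at a time: a colour without its cycle leaves a few large vertex sets
  between which it has no edge at all. Once every colour is eliminated, two disjoint \<open>n\<close>-sets remain
  with no edge between them, a contradiction.

  The engine is that a pair of large clusters without such a hole contains paths of every
  admissible length: two breadth-first trees in disjoint expanding parts supply many end vertices at
  an exact depth, and a depth-first path of prescribed length connects the two trees. An even colour
  is thus eliminated from one pair of clusters. For an odd colour, an odd cycle of clusters with no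
  holes would close up to the forbidden odd cycle, so the pairs without holes form a bipartite
  graph, and more than half of an odd number of clusters can be made pairwise free of that colour.
\<close>

section \<open>Joined sets and paths\<close>

definition edge_free :: "('a \<Rightarrow> 'a \<Rightarrow> bool) \<Rightarrow> 'a set \<Rightarrow> 'a set \<Rightarrow> bool" where
  "edge_free R A B \<longleftrightarrow> (\<forall>x\<in>A. \<forall>y\<in>B. \<not> R x y)"

definition joined :: "('a \<Rightarrow> 'a \<Rightarrow> bool) \<Rightarrow> 'a set \<Rightarrow> nat \<Rightarrow> 'a set \<Rightarrow> nat \<Rightarrow> bool" where
  "joined R A k B l \<longleftrightarrow>
     (\<forall>X Y. X \<subseteq> A \<longrightarrow> Y \<subseteq> B \<longrightarrow> k \<le> card X \<longrightarrow> l \<le> card Y \<longrightarrow> \<not> edge_free R X Y)"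

definition nonneighbours :: "('a \<Rightarrow> 'a \<Rightarrow> bool) \<Rightarrow> 'a set \<Rightarrow> 'a set \<Rightarrow> 'a set" where
  "nonneighbours R X B = {y \<in> B. \<forall>x\<in>X. \<not> R x y}"

lemma finite_nonneighbours [simp]: "finite B \<Longrightarrow> finite (nonneighbours R X B)"
  by (simp add: nonneighbours_def)

lemma edge_free_mono: "edge_free R A B \<Longrightarrow> A' \<subseteq> A \<Longrightarrow> B' \<subseteq> B \<Longrightarrow> edge_free R A' B'"
  by (auto simp: edge_free_def)

lemma edge_free_sym: "symp R \<Longrightarrow> edge_free R A B \<Longrightarrow> edge_free R B A"
  by (auto simp: edge_free_def dest: sympD)

lemma joined_mono: "joined R A k B l \<Longrightarrow> A' \<subseteq> A \<Longrightarrow> B' \<subseteq> B \<Longrightarrow> joined R A' k B' l"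
  unfolding joined_def by (meson subset_trans)

lemma joined_sym: "symp R \<Longrightarrow> joined R A k B l \<Longrightarrow> joined R B l A k"
  unfolding joined_def using edge_free_sym by metis

lemma not_joined_imp_edge_free:
  assumes "\<not> joined R A k B l"
  obtains X Y where "X \<subseteq> A" "Y \<subseteq> B" "card X = k" "card Y = l" "edge_free R X Y"
proof -
  obtain X Y where XY: "X \<subseteq> A" "Y \<subseteq> B" "k \<le> card X" "l \<le> card Y" "edge_free R X Y"
    using assms by (auto simp: joined_def)
  obtain X' where X': "X' \<subseteq> X" "card X' = k" using XY(3) by (rule obtain_subset_with_card_n)
  obtain Y' where Y': "Y' \<subseteq> Y" "card Y' = l" using XY(4) by (rule obtain_subset_with_card_n)
  show ?thesis
    by (rule that[of X' Y']) (use XY X' Y' in \<open>auto intro: edge_free_mono\<close>)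
qed

lemma joined_imp_few_nonneighbours:
  assumes "joined R A k B l" "X \<subseteq> A" "k \<le> card X"
  shows "card (nonneighbours R X B) < l"
proof (rule ccontr)
  assume "\<not> ?thesis"
  then have "\<not> edge_free R X (nonneighbours R X B)"
    using assms unfolding joined_def by (auto simp: nonneighbours_def)
  then show False by (auto simp: edge_free_def nonneighbours_def)
qed

lemma obtain_disjoint_subsets:
  assumes "finite A" "m + n \<le> card A"
  obtains X Y where "X \<subseteq> A" "Y \<subseteq> A" "X \<inter> Y = {}" "card X = m" "card Y = n"
proof -
  obtain X where X: "X \<subseteq> A" "card X = m"
    using assms(2) by (meson add_leD1 obtain_subset_with_card_n)
  then have "n \<le> card (A - X)" using assms by (simp add: card_Diff_subset finite_subset)
  then obtain Y where "Y \<subseteq> A - X" "card Y = n" by (rule obtain_subset_with_card_n)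
  with X show ?thesis by (intro that[of X Y]) auto
qed

lemma obtain_three_disjoint_subsets:
  assumes "finite A" "l + m + n \<le> card A"
  obtains X Y Z where "X \<subseteq> A" "Y \<subseteq> A" "Z \<subseteq> A" "X \<inter> Y = {}" "X \<inter> Z = {}" "Y \<inter> Z = {}"
    "card X = l" "card Y = m" "card Z = n"
proof -
  have "l + (m + n) \<le> card A" using assms(2) by simp
  then obtain X W where X: "X \<subseteq> A" "W \<subseteq> A" "X \<inter> W = {}" "card X = l" "card W = m + n"
    by (rule obtain_disjoint_subsets[OF assms(1)])
  have "finite W" using X(2) assms(1) by (rule finite_subset)
  then obtain Y Z where "Y \<subseteq> W" "Z \<subseteq> W" "Y \<inter> Z = {}" "card Y = m" "card Z = n"
    using X(5) by (metis obtain_disjoint_subsets order_refl)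
  with X show ?thesis by (intro that[of X Y Z]) auto
qed

text \<open>The order of a path is its number of vertices.\<close>

definition path_of_order :: "('a \<Rightarrow> 'a \<Rightarrow> bool) \<Rightarrow> 'a set \<Rightarrow> nat \<Rightarrow> 'a \<Rightarrow> 'a \<Rightarrow> bool" where
  "path_of_order R V l x y \<longleftrightarrow>
     (\<exists>xs. xs \<noteq> [] \<and> length xs = l \<and> hd xs = x \<and> last xs = y \<and> distinct xs \<and>
           successively R xs \<and> set xs \<subseteq> V)"

lemma path_of_order_singleton: "x \<in> V \<Longrightarrow> path_of_order R V (Suc 0) x x"
  unfolding path_of_order_def by (rule exI[of _ "[x]"]) simp

lemma path_of_order_mono:
  assumes "path_of_order R V l x y" "V \<subseteq> W" "\<And>u v. R u v \<Longrightarrow> R' u v"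
  shows "path_of_order R' W l x y"
proof -
  obtain xs where "xs \<noteq> []" "length xs = l" "hd xs = x" "last xs = y" "distinct xs"
    "successively R xs" "set xs \<subseteq> V"
    using assms(1) by (auto simp: path_of_order_def)
  moreover from this have "successively R' xs" using assms(3) by (blast intro: successively_mono)
  ultimately show ?thesis using assms(2) unfolding path_of_order_def by blast
qed

lemma path_of_order_append:
  assumes "path_of_order R V l x u" "R u v" "path_of_order R W m v y" "V \<inter> W = {}"
  shows "path_of_order R (V \<union> W) (l + m) x y"
proof -
  obtain xs where xs: "xs \<noteq> []" "length xs = l" "hd xs = x" "last xs = u" "distinct xs"
    "successively R xs" "set xs \<subseteq> V"
    using assms(1) by (auto simp: path_of_order_def)
  obtain ys where ys: "ys \<noteq> []" "length ys = m" "hd ys = v" "last ys = y" "distinct ys"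
    "successively R ys" "set ys \<subseteq> W"
    using assms(3) by (auto simp: path_of_order_def)
  show ?thesis
    unfolding path_of_order_def
    using xs ys assms(2,4) by (intro exI[of _ "xs @ ys"]) (auto simp: successively_append_iff)
qed

lemma path_of_order_sym:
  assumes "symp R" "path_of_order R V l x y"
  shows "path_of_order R V l y x"
proof -
  obtain xs where xs: "xs \<noteq> []" "length xs = l" "hd xs = x" "last xs = y" "distinct xs"
    "successively R xs" "set xs \<subseteq> V"
    using assms(2) by (auto simp: path_of_order_def)
  have "successively R (rev xs)"
    unfolding successively_rev using xs(6) by (rule successively_mono) (rule sympD[OF assms(1)])
  with xs show ?thesis
    unfolding path_of_order_def by (intro exI[of _ "rev xs"]) (auto simp: hd_rev last_rev)
qed

section \<open>Breadth-first and depth-first search\<close>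

definition nbh :: "('a \<Rightarrow> 'a \<Rightarrow> bool) \<Rightarrow> 'a set \<Rightarrow> 'a set \<Rightarrow> 'a set" where
  "nbh R W S = {y \<in> W - S. \<exists>x\<in>S. R x y}"

definition expander ::
    "('a \<Rightarrow> 'a \<Rightarrow> bool) \<Rightarrow> 'a set \<Rightarrow> ('a \<Rightarrow> nat) \<Rightarrow> nat \<Rightarrow> nat \<Rightarrow> bool" where
  "expander R W w m Q \<longleftrightarrow>
     (\<forall>S\<subseteq>W. S \<noteq> {} \<longrightarrow> sum w S < Q \<longrightarrow> m * sum w S < sum w (nbh R W S))"

text \<open>Discard a maximal set of weight below \<open>Q\<close> that fails to expand: the union with another failing
  set would again fail to expand, hence have weight below \<open>Q\<close>, against maximality.\<close>

lemma obtain_expander: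
  fixes w :: "'a \<Rightarrow> nat"
  assumes fin: "finite W" and "0 < Q"
    and heavy: "\<And>T. T \<subseteq> W \<Longrightarrow> Q \<le> sum w T \<Longrightarrow> sum w T < 2 * Q \<Longrightarrow>
                  m * sum w T < sum w (nbh R W T)"
  obtains U where "U \<subseteq> W" "sum w U < Q" "expander R (W - U) w m Q"
proof -
  define \<U> where "\<U> = {U. U \<subseteq> W \<and> sum w U < Q \<and> sum w (nbh R W U) \<le> m * sum w U}"
  have "{} \<in> \<U>" using \<open>0 < Q\<close> by (auto simp: \<U>_def nbh_def)
  moreover have "finite \<U>" using fin by (simp add: \<U>_def)
  ultimately obtain U where "U \<in> \<U>" and maximal: "\<And>T. T \<in> \<U> \<Longrightarrow> U \<subseteq> T \<Longrightarrow> U = T"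
    by (metis empty_iff finite_has_maximal)
  then have U: "U \<subseteq> W" "sum w U < Q" "sum w (nbh R W U) \<le> m * sum w U" by (auto simp: \<U>_def)
  have "m * sum w S < sum w (nbh R (W - U) S)" if S: "S \<subseteq> W - U" "S \<noteq> {}" "sum w S < Q" for S
  proof (rule ccontr)
    assume "\<not> ?thesis"
    then have small: "sum w (nbh R (W - U) S) \<le> m * sum w S" by simp
    have finite_nbh: "finite (nbh R W U)" "finite (nbh R (W - U) S)"
      using fin by (auto simp: nbh_def)
    have weight_Un: "sum w (U \<union> S) = sum w U + sum w S"
      using S(1) U(1) fin by (intro sum.union_disjoint) (auto intro: finite_subset)
    have "sum w (nbh R W (U \<union> S)) \<le> sum w (nbh R W U \<union> nbh R (W - U) S)"
      by (rule sum_mono2) (use finite_nbh in \<open>auto simp: nbh_def\<close>)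
    also have "\<dots> \<le> sum w (nbh R W U) + sum w (nbh R (W - U) S)"
      using sum.union_inter[OF finite_nbh, of w] by simp
    also have "\<dots> \<le> m * sum w (U \<union> S)"
      unfolding weight_Un add_mult_distrib2 using small U(3) by (rule add_mono[rotated])
    finally have not_expanding: "sum w (nbh R W (U \<union> S)) \<le> m * sum w (U \<union> S)" .
    have "U \<union> S \<subseteq> W" using S(1) U(1) by auto
    moreover have "sum w (U \<union> S) < Q"
      using heavy[OF \<open>U \<union> S \<subseteq> W\<close>] not_expanding weight_Un S(3) U(2) by linarith
    ultimately have "U \<union> S \<in> \<U>" using not_expanding by (simp add: \<U>_def)
    from maximal[OF this] show False using S(1,2) by blast
  qed
  with U show ?thesis by (intro that[of U]) (auto simp: expander_def)
qed

primrec bfs_ball :: "('a \<Rightarrow> 'a \<Rightarrow> bool) \<Rightarrow> 'a set \<Rightarrow> 'a \<Rightarrow> nat \<Rightarrow> 'a set" where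
  "bfs_ball R W r 0 = {r}"
| "bfs_ball R W r (Suc i) = bfs_ball R W r i \<union> nbh R W (bfs_ball R W r i)"

primrec bfs_sphere :: "('a \<Rightarrow> 'a \<Rightarrow> bool) \<Rightarrow> 'a set \<Rightarrow> 'a \<Rightarrow> nat \<Rightarrow> 'a set" where
  "bfs_sphere R W r 0 = {r}"
| "bfs_sphere R W r (Suc i) = nbh R W (bfs_ball R W r i)"

lemma bfs_ball_subset: "r \<in> W \<Longrightarrow> bfs_ball R W r i \<subseteq> W"
  by (induction i) (auto simp: nbh_def)

lemma bfs_ball_nonempty: "bfs_ball R W r i \<noteq> {}"
  by (induction i) auto

lemma bfs_sphere_subset: "bfs_sphere R W r i \<subseteq> bfs_ball R W r i"
  by (cases i) auto

lemma neighbour_of_bfs_interior: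
  assumes "y \<in> bfs_ball R W r i - bfs_sphere R W r i" "R y x" "x \<in> W"
  shows "x \<in> bfs_ball R W r i"
  using assms by (cases i) (auto simp: nbh_def)

lemma path_to_bfs_sphere:
  assumes "x \<in> bfs_sphere R W r i"
  shows "path_of_order R (bfs_ball R W r i) (Suc i) r x"
  using assms
proof (induction i arbitrary: x)
  case 0
  then show ?case by (simp add: path_of_order_singleton)
next
  case (Suc i)
  then obtain y where parent: "y \<in> bfs_ball R W r i" "R y x" "x \<in> W" "x \<notin> bfs_ball R W r i"
    by (auto simp: nbh_def)
  then have "y \<in> bfs_sphere R W r i" using neighbour_of_bfs_interior by fastforce
  then have "path_of_order R (bfs_ball R W r i) (Suc i) r y" by (rule Suc.IH)
  then have "path_of_order R (bfs_ball R W r i \<union> {x}) (Suc i + Suc 0) r x"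
    using parent(2,4) by (intro path_of_order_append[OF _ _ path_of_order_singleton]) auto
  then have "path_of_order R (bfs_ball R W r (Suc i)) (Suc i + Suc 0) r x"
    by (rule path_of_order_mono) (use Suc.prems in auto)
  then show ?case by simp
qed

lemma sum_bfs_ball_Suc:
  assumes "finite W" "r \<in> W"
  shows "sum w (bfs_ball R W r (Suc i)) =
           sum w (bfs_ball R W r i) + sum w (bfs_sphere R W r (Suc i))"
  using assms bfs_ball_subset[OF assms(2), of R i]
  by (auto simp: nbh_def intro!: sum.union_disjoint intro: finite_subset)

lemma bfs_sphere_heavy:
  assumes "finite W" "r \<in> W" "expander R W w m Q" "sum w (bfs_ball R W r i) < Q"
  shows "m * sum w (bfs_ball R W r i) < sum w (bfs_sphere R W r (Suc i))"
  using assms bfs_ball_subset[OF assms(2), of R i] bfs_ball_nonempty[of R W r i]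
  by (simp add: expander_def)

lemma bfs_ball_growth:
  assumes "finite W" "r \<in> W" "expander R W w m Q"
    and "\<And>j. j < i \<Longrightarrow> sum w (bfs_ball R W r j) < Q"
  shows "Suc m ^ i * w r \<le> sum w (bfs_ball R W r i)"
  using assms(4)
proof (induction i)
  case (Suc i)
  have "Suc m ^ Suc i * w r \<le> Suc m * sum w (bfs_ball R W r i)"
    unfolding power_Suc mult.assoc using Suc.IH Suc.prems by (intro mult_le_mono2) simp
  also have "\<dots> \<le> sum w (bfs_ball R W r (Suc i))"
    using bfs_sphere_heavy[OF assms(1-3) Suc.prems[OF lessI]]
    unfolding sum_bfs_ball_Suc[OF assms(1,2)] mult_Suc by linarith
  finally show ?case .
qed simp

text \<open>The layer is the sphere of the first radius at which the ball reaches weight \<open>Q\<close>.\<close>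

lemma expander_bfs_layer:
  fixes w :: "'a \<Rightarrow> nat"
  assumes fin: "finite W" and root: "r \<in> W" "0 < w r" and expander: "expander R W w m Q"
    and pos: "0 < m"
  obtains d X where "X \<subseteq> W" "m * Q \<le> Suc m * sum w X" "d = 0 \<or> Suc m ^ (d - 1) * w r < Q"
    "\<And>x. x \<in> X \<Longrightarrow> path_of_order R W (Suc d) r x"
proof -
  let ?B = "bfs_ball R W r" and ?S = "bfs_sphere R W r"
  have "\<exists>d. Q \<le> sum w (?B d)"
  proof (rule ccontr)
    assume "\<nexists>d. Q \<le> sum w (?B d)"
    then have light: "sum w (?B d) < Q" for d by (simp add: not_le)
    have "Q < Suc m ^ Q" using pos by (intro power_gt_expt) simp
    also have "\<dots> \<le> Suc m ^ Q * w r" using root(2) by simp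
    also have "\<dots> \<le> sum w (?B Q)" by (rule bfs_ball_growth[OF fin root(1) expander light])
    finally show False using light[of Q] by simp
  qed
  then obtain d where heavy: "Q \<le> sum w (?B d)" and light: "\<And>j. j < d \<Longrightarrow> sum w (?B j) < Q"
    using exists_least_iff[of "\<lambda>d. Q \<le> sum w (?B d)"] by (auto simp: not_le)
  show ?thesis
  proof (rule that[of "?S d" d])
    show "?S d \<subseteq> W" using bfs_sphere_subset bfs_ball_subset[OF root(1)] by (rule subset_trans)
    show "path_of_order R W (Suc d) r x" if "x \<in> ?S d" for x
      using path_to_bfs_sphere[OF that] bfs_ball_subset[OF root(1)] by (rule path_of_order_mono)
    show "m * Q \<le> Suc m * sum w (?S d)"
    proof (cases d)
      case 0
      then show ?thesis using heavy by (intro mult_le_mono) auto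
    next
      case (Suc e)
      have "m * Q \<le> m * (sum w (?B e) + sum w (?S d))"
        using heavy unfolding Suc sum_bfs_ball_Suc[OF fin root(1)] by (rule mult_le_mono2)
      also have "\<dots> \<le> Suc m * sum w (?S d)"
        using bfs_sphere_heavy[OF fin root(1) expander light, of e]
        by (simp add: Suc add_mult_distrib2)
      finally show ?thesis .
    qed
    show "d = 0 \<or> Suc m ^ (d - 1) * w r < Q"
    proof (cases d)
      case (Suc e)
      have "Suc m ^ e * w r \<le> sum w (?B e)"
        using light by (intro bfs_ball_growth[OF fin root(1) expander]) (simp add: Suc)
      also have "\<dots> < Q" using light by (simp add: Suc)
      finally show ?thesis by (simp add: Suc)
    qed simp
  qed
qed

text \<open>\<open>S\<close> is the set of finished vertices and \<open>xs\<close> the stack; no edge leads from an unexplored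
  vertex to a finished one. The search stops as soon as the finished vertices satisfy \<open>Q\<close>.\<close>

lemma dfs_partition:
  assumes fin: "finite V" and "\<not> Q {}" and stop_at_all: "Q V"
  obtains S x xs where "insert x S \<subseteq> V" "\<not> Q S" "Q (insert x S)" "distinct xs" "successively R xs"
    "set xs \<subseteq> V - insert x S" "edge_free R (V - insert x S - set xs) (insert x S)"
proof -
  define state where "state S xs \<longleftrightarrow> S \<subseteq> V \<and> distinct xs \<and> successively R xs \<and>
    set xs \<subseteq> V - S \<and> edge_free R (V - S - set xs) S" for S xs
  have "\<exists>S x xs. \<not> Q S \<and> Q (insert x S) \<and> state (insert x S) xs" if "state S xs" "\<not> Q S" for S xs
    using that
  proof (induction "2 * card (V - S) - length xs" arbitrary: S xs rule: less_induct)
    case less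
    have short: "length xs \<le> card (V - S)"
      using less.prems(1) fin by (metis card_mono distinct_card finite_Diff state_def)
    show ?case
    proof (cases "\<exists>u\<in>V - S - set xs. xs = [] \<or> R u (hd xs)")
      case True
      then obtain u where unexplored: "u \<in> V - S - set xs" "xs = [] \<or> R u (hd xs)" by blast
      have push: "state S (u # xs)"
        using less.prems(1) unexplored by (auto simp: state_def successively_Cons edge_free_def)
      then have "length (u # xs) \<le> card (V - S)"
        using fin by (metis card_mono distinct_card finite_Diff state_def)
      then show ?thesis using push less.prems(2) by (intro less.hyps[of S "u # xs"]) auto
    next
      case False
      have "S \<noteq> V" using less.prems(2) stop_at_all by blast
      then obtain x ys where xs: "xs = x # ys"
        using False less.prems(1) by (cases xs) (auto simp: state_def)
      have pop: "state (insert x S) ys"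
        using less.prems(1) False by (auto simp: state_def xs successively_Cons edge_free_def)
      have "card (V - S) = Suc (card (V - insert x S))"
        using fin less.prems(1) card.remove[of "V - S" x]
        by (simp add: state_def xs Diff_insert[symmetric])
      then have "2 * card (V - insert x S) - length ys < 2 * card (V - S) - length xs"
        using short by (simp add: xs)
      then show ?thesis using less.hyps pop less.prems(2) by blast
    qed
  qed
  moreover have "state {} []" by (simp add: state_def edge_free_def)
  ultimately obtain S x xs where "\<not> Q S" "Q (insert x S)" "state (insert x S) xs"
    using \<open>\<not> Q {}\<close> by blast
  then show ?thesis by (intro that[of x S xs]) (auto simp: state_def)
qed

section \<open>Paths of every even order in a joined pair\<close>

definition crossing :: "('a \<Rightarrow> 'a \<Rightarrow> bool) \<Rightarrow> (bool \<Rightarrow> 'a set) \<Rightarrow> 'a \<Rightarrow> 'a \<Rightarrow> bool" where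
  "crossing R V x y \<longleftrightarrow> R x y \<and> (\<exists>c. x \<in> V c \<and> y \<in> V (\<not> c))"

lemma last_crossing:
  assumes disj: "\<And>c. V c \<inter> V (\<not> c) = {}"
    and "successively (crossing R V) xs" "xs \<noteq> []" "hd xs \<in> V b"
  shows "last xs \<in> V (b = odd (length xs))"
  using assms(2-4)
proof (induction xs arbitrary: b)
  case (Cons x xs)
  show ?case
  proof (cases xs)
    case Nil
    then show ?thesis using Cons.prems by simp
  next
    case (Cons y ys)
    then obtain c where sides: "x \<in> V c" "y \<in> V (\<not> c)"
      using Cons.prems by (auto simp: crossing_def)
    have "c = b" using sides(1) Cons.prems(3) disj[of c] by (cases "c = b") auto
    then have "last xs \<in> V ((\<not> b) = odd (length xs))"
      using Cons.IH[of "\<not> b"] Cons.prems sides Cons by auto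
    moreover have "((\<not> b) = odd (length xs)) = (b = odd (length (x # xs)))" by auto
    ultimately show ?thesis using Cons by simp
  qed
qed simp

locale joined_pair =
  fixes R :: "'a \<Rightarrow> 'a \<Rightarrow> bool" and V :: "bool \<Rightarrow> 'a set" and k :: "bool \<Rightarrow> nat"
  assumes sym: "symp R"
    and finite_side: "finite (V c)"
    and sides_disjoint: "V c \<inter> V (\<not> c) = {}"
    and threshold_pos: "0 < k c"
    and joined_sides: "joined R (V c) (k c) (V (\<not> c)) (k (\<not> c))"

lemma joined_pair_subset:
  assumes "joined_pair R V k" "\<And>c. W c \<subseteq> V c"
  shows "joined_pair R W k"
proof -
  interpret joined_pair R V k by (rule assms(1))
  show ?thesis
  proof
    show "finite (W c)" for c using assms(2) finite_side by (rule finite_subset)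
    show "W c \<inter> W (\<not> c) = {}" for c
      using assms(2)[of c] assms(2)[of "\<not> c"] sides_disjoint[of c] by blast
    show "joined R (W c) (k c) (W (\<not> c)) (k (\<not> c))" for c
      using joined_sides assms(2) assms(2) by (rule joined_mono)
  qed (rule sym threshold_pos)+
qed

context joined_pair
begin

abbreviation sides :: "'a set" where
  "sides \<equiv> \<Union>c. V c"

lemma finite_sides: "finite sides"
  using finite_side by simp

lemma in_side_iff: "v \<in> sides \<Longrightarrow> v \<in> V (\<not> c) \<longleftrightarrow> v \<notin> V c"
  using sides_disjoint[of c] by (cases c) (auto simp: UNIV_bool)

lemma few_nonneighbours:
  assumes "X \<subseteq> V c" "k c \<le> card X"
  shows "card (nonneighbours R X (V (\<not> c))) < k (\<not> c)"
  using joined_sides assms by (rule joined_imp_few_nonneighbours)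

lemma long_crossing_path:
  assumes size: "\<And>c. 2 * k c + L \<le> card (V c)"
  obtains xs where "L < length xs" "distinct xs" "successively (crossing R V) xs" "set xs \<subseteq> sides"
proof -
  define big where "big S \<longleftrightarrow> (\<exists>c. k c \<le> card (S \<inter> V c))" for S
  have "\<not> big {}" using threshold_pos by (simp add: big_def)
  moreover have "big sides"
  proof -
    have "sides \<inter> V True = V True" by auto
    then show ?thesis unfolding big_def using size[of True] by (intro exI[of _ True]) simp
  qed
  ultimately obtain S x xs where finished: "insert x S \<subseteq> sides" "\<not> big S" "big (insert x S)"
    and xs: "distinct xs" "successively (crossing R V) xs" "set xs \<subseteq> sides - insert x S"
    and free: "edge_free (crossing R V) (sides - insert x S - set xs) (insert x S)"
    by (rule dfs_partition[OF finite_sides])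
  let ?S = "insert x S" and ?U = "sides - insert x S - set xs"
  obtain c where big_side: "k c \<le> card (?S \<inter> V c)" using finished(3) by (auto simp: big_def)
  let ?N = "nonneighbours R (?S \<inter> V c) (V (\<not> c))"
  have "?U \<inter> V (\<not> c) \<subseteq> ?N"
    using free sympD[OF sym] by (fastforce simp: edge_free_def crossing_def nonneighbours_def)
  then have "V (\<not> c) \<subseteq> (?S \<inter> V (\<not> c)) \<union> ?N \<union> set xs" by blast
  then have "card (V (\<not> c)) \<le> card ((?S \<inter> V (\<not> c)) \<union> ?N \<union> set xs)"
    using finite_side by (intro card_mono) auto
  also have "\<dots> \<le> card (?S \<inter> V (\<not> c)) + card ?N + card (set xs)"
    by (meson card_Un_le add_le_mono1 le_trans)
  finally have "card (V (\<not> c)) \<le> card (?S \<inter> V (\<not> c)) + card ?N + length xs"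
    using card_length[of xs] by linarith
  moreover have "card ?N < k (\<not> c)" using big_side by (intro few_nonneighbours) auto
  moreover have "card (?S \<inter> V (\<not> c)) \<le> k (\<not> c)"
  proof -
    have "card (?S \<inter> V (\<not> c)) \<le> card (insert x (S \<inter> V (\<not> c)))"
      using finite_side by (intro card_mono) auto
    also have "\<dots> \<le> Suc (card (S \<inter> V (\<not> c)))" by (rule card_insert_le_m1) simp_all
    also have "\<dots> \<le> k (\<not> c)" using finished(2) by (simp add: big_def not_le Suc_le_eq)
    finally show ?thesis .
  qed
  ultimately have "L < length xs" using size[of "\<not> c"] by linarith
  then show ?thesis using xs by (intro that[of xs]) auto
qed

lemma path_of_every_order:
  assumes size: "\<And>c. 2 * k c + L \<le> card (V c)" and pos: "0 < L"
  obtains u v where "u \<in> V b" "v \<in> V (b = odd L)" "path_of_order R sides L u v"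
proof -
  obtain xs where xs: "L < length xs" "distinct xs" "successively (crossing R V) xs"
      "set xs \<subseteq> sides"
    using size by (rule long_crossing_path)
  obtain x y ys where xy: "xs = x # y # ys" using xs(1) pos by (cases xs; cases "tl xs") auto
  define ws where "ws = (if x \<in> V b then xs else y # ys)"
  have ws: "L \<le> length ws" "distinct ws" "successively (crossing R V) ws" "set ws \<subseteq> sides"
    using xs by (auto simp: ws_def xy)
  have "hd ws \<in> V b"
  proof (cases "x \<in> V b")
    case False
    moreover obtain c where "x \<in> V c" "y \<in> V (\<not> c)" using xs(3) by (auto simp: xy crossing_def)
    ultimately have "y \<in> V b" by (cases b; cases c) auto
    then show ?thesis using False by (simp add: ws_def)
  qed (simp add: ws_def xy)
  define zs where "zs = take L ws"
  have zs: "zs \<noteq> []" "length zs = L" "distinct zs" "set zs \<subseteq> sides" "hd zs \<in> V b"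
    using ws \<open>hd ws \<in> V b\<close> pos set_take_subset[of L ws] by (auto simp: zs_def)
  have cross: "successively (crossing R V) zs"
    using ws(3) unfolding zs_def by (metis append_take_drop_id successively_append_iff)
  have "last zs \<in> V (b = odd L)"
    using last_crossing[OF sides_disjoint cross zs(1,5)] by (simp add: zs(2))
  moreover have "successively R zs" using cross by (rule successively_mono) (simp add: crossing_def)
  ultimately show ?thesis
    using zs by (intro that[of "hd zs" "last zs"]) (auto simp: path_of_order_def)
qed

text \<open>With these weights the thresholds \<open>k True\<close> and \<open>k False\<close> are equally heavy, which makes the
  expansion argument work for sides of very different sizes.\<close>

definition weight :: "'a \<Rightarrow> nat" where
  "weight v = (if v \<in> V True then k False else k True)"

lemma weight_in_side: "v \<in> V c \<Longrightarrow> weight v = k (\<not> c)"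
  using sides_disjoint[of True] by (cases c) (auto simp: weight_def)

lemma sum_weight_in_side: "T \<subseteq> V c \<Longrightarrow> sum weight T = k (\<not> c) * card T"
  using weight_in_side[of _ c] by (subst sum.cong[of T T weight "\<lambda>_. k (\<not> c)"]) auto

lemma sum_weight:
  assumes "T \<subseteq> sides"
  shows "sum weight T = k (\<not> c) * card (T \<inter> V c) + k c * card (T \<inter> V (\<not> c))"
proof -
  have "T = (T \<inter> V c) \<union> (T \<inter> V (\<not> c))" using assms in_side_iff[of _ c] by blast
  then have "sum weight T = sum weight ((T \<inter> V c) \<union> (T \<inter> V (\<not> c)))" by simp
  also have "\<dots> = sum weight (T \<inter> V c) + sum weight (T \<inter> V (\<not> c))"
    using finite_side sides_disjoint[of c] by (intro sum.union_disjoint) auto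
  finally show ?thesis
    using sum_weight_in_side[of "T \<inter> V c" c] sum_weight_in_side[of "T \<inter> V (\<not> c)" "\<not> c"] by simp
qed

lemma nbh_covers_opposite_side:
  assumes big_side: "k c \<le> card (T \<inter> V c)"
  shows "card (V (\<not> c)) <
           card (nbh (crossing R V) sides T \<inter> V (\<not> c)) + card (T \<inter> V (\<not> c)) + k (\<not> c)"
    (is "_ < card ?N + card ?T + _")
proof -
  let ?Z = "nonneighbours R (T \<inter> V c) (V (\<not> c))"
  have "V (\<not> c) \<subseteq> ?N \<union> ?T \<union> ?Z" by (auto simp: nbh_def crossing_def nonneighbours_def)
  then have "card (V (\<not> c)) \<le> card (?N \<union> ?T \<union> ?Z)"
    by (rule card_mono[rotated]) (use finite_side in auto)
  also have "\<dots> \<le> card ?N + card ?T + card ?Z" by (meson card_Un_le add_le_mono1 le_trans)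
  also have "card ?Z < k (\<not> c)" using big_side by (intro few_nonneighbours) auto
  finally show ?thesis by simp
qed

abbreviation threshold_weight :: nat where
  "threshold_weight \<equiv> k True * k False"

lemma threshold_weight_eq: "threshold_weight = k c * k (\<not> c)"
  by (cases c) auto

lemma heavy_set_hits_threshold:
  assumes "T \<subseteq> sides" "2 * threshold_weight \<le> sum weight T"
  obtains c where "k c \<le> card (T \<inter> V c)"
proof (rule ccontr)
  assume "\<not> ?thesis"
  then have "card (T \<inter> V c) < k c" for c using that not_le by blast
  then have "k (\<not> c) * card (T \<inter> V c) < k (\<not> c) * k c" for c using threshold_pos by simp
  from add_strict_mono[OF this[of True] this[of False]] show False
    using assms(2) sum_weight[OF assms(1), of True] by (simp add: mult.commute)
qed

lemma heavy_set_expands: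
  assumes size: "\<And>c. 10 * k c \<le> card (V c)"
    and heavy: "T \<subseteq> sides" "2 * threshold_weight \<le> sum weight T"
      "sum weight T < 4 * threshold_weight"
  shows "2 * sum weight T < sum weight (nbh (crossing R V) sides T)" (is "_ < sum weight ?N")
proof -
  have "?N \<subseteq> sides" by (auto simp: nbh_def)
  note sums = sum_weight[OF this] sum_weight[OF heavy(1)]
  have near: "9 * threshold_weight < k c * card (?N \<inter> V (\<not> c)) + k c * card (T \<inter> V (\<not> c))"
    if "k c \<le> card (T \<inter> V c)" for c
  proof -
    have "9 * k (\<not> c) < card (?N \<inter> V (\<not> c)) + card (T \<inter> V (\<not> c))"
      using nbh_covers_opposite_side[OF that] size[of "\<not> c"] by linarith
    then have "k c * (9 * k (\<not> c)) < k c * (card (?N \<inter> V (\<not> c)) + card (T \<inter> V (\<not> c)))"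
      using threshold_pos by simp
    then show ?thesis
      unfolding threshold_weight_eq[of c] by (simp only: mult.left_commute add_mult_distrib2)
  qed
  obtain c where big_side: "k c \<le> card (T \<inter> V c)"
    using heavy(1,2) by (rule heavy_set_hits_threshold)
  show ?thesis
  proof (cases "k (\<not> c) \<le> card (T \<inter> V (\<not> c))")
    case True
    then have "18 * threshold_weight < sum weight ?N + sum weight T"
      using near[OF big_side] near[OF True] sums[of c] by simp
    then show ?thesis using heavy(3) by simp
  next
    case False
    then have "k c * card (T \<inter> V (\<not> c)) \<le> threshold_weight"
      unfolding threshold_weight_eq[of c] by (intro mult_le_mono2) simp
    then have "8 * threshold_weight < sum weight ?N"
      using near[OF big_side] sums(1)[of c] by linarith
    then show ?thesis using heavy(3) by simp
  qed
qed

text \<open>A crossing path with \<open>d\<close> edges leads from side \<open>b\<close> to side \<open>b = even d\<close>.\<close>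

definition branches :: "nat \<Rightarrow> bool \<Rightarrow> 'a \<Rightarrow> bool" where
  "branches h b r \<longleftrightarrow> (\<exists>d\<le>h. \<exists>X\<subseteq>V (b = even d). k (b = even d) \<le> card X \<and>
     (\<forall>x\<in>X. path_of_order R sides (Suc d) r x))"

lemma branches_if_expander:
  assumes expander: "expander (crossing R V) W weight 2 (2 * threshold_weight)"
    and subset: "W \<subseteq> sides"
    and root: "r \<in> W" "r \<in> V b" and scale: "2 * k b \<le> 3 ^ h"
  shows "branches h b r"
proof -
  have "finite W" using subset finite_sides by (rule finite_subset)
  moreover have weight_root: "weight r = k (\<not> b)" using root(2) by (rule weight_in_side)
  ultimately obtain d X where layer: "X \<subseteq> W" "2 * (2 * threshold_weight) \<le> 3 * sum weight X"
    and depth: "d = 0 \<or> 3 ^ (d - 1) * k (\<not> b) < 2 * threshold_weight"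
    and paths: "\<And>x. x \<in> X \<Longrightarrow> path_of_order (crossing R V) W (Suc d) r x"
    using expander_bfs_layer[OF _ root(1) _ expander] threshold_pos[of "\<not> b"]
    by (metis numeral_3_eq_3 numeral_2_eq_2 zero_less_Suc)
  let ?c = "b = even d"
  have side: "X \<subseteq> V ?c"
  proof
    fix x assume "x \<in> X"
    from paths[OF this] obtain xs where xs: "xs \<noteq> []" "length xs = Suc d" "hd xs = r" "last xs = x"
        "successively (crossing R V) xs"
      by (auto simp: path_of_order_def)
    show "x \<in> V ?c" using last_crossing[OF sides_disjoint xs(5,1)] xs root(2) by simp
  qed
  have "4 * k ?c \<le> 3 * card X"
  proof -
    have "k (\<not> ?c) * (4 * k ?c) \<le> k (\<not> ?c) * (3 * card X)"
      using layer(2) unfolding sum_weight_in_side[OF side] threshold_weight_eq[of ?c]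
      by (simp only: mult_ac)
    then show ?thesis using threshold_pos[of "\<not> ?c"] by simp
  qed
  moreover have "d \<le> h"
    using depth
  proof
    assume "3 ^ (d - 1) * k (\<not> b) < 2 * threshold_weight"
    then have "3 ^ (d - 1) * k (\<not> b) < (2 * k b) * k (\<not> b)"
      by (simp add: threshold_weight_eq[of b] mult.assoc)
    then have "3 ^ (d - 1) < 2 * k b" by simp
    also have "\<dots> \<le> 3 ^ h" by (rule scale)
    finally have "d - 1 < h" by simp
    then show ?thesis by simp
  qed simp
  moreover have "path_of_order R sides (Suc d) r x" if "x \<in> X" for x
    using paths[OF that] subset by (rule path_of_order_mono) (simp add: crossing_def)
  ultimately show ?thesis
    unfolding branches_def using side by (intro exI[of _ d] exI[of _ X] conjI) auto
qed

lemma many_branching: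
  assumes size: "\<And>c. 10 * k c \<le> card (V c)" and scale: "2 * k b \<le> 3 ^ h"
  shows "card (V b) < card {r \<in> V b. branches h b r} + 2 * k b"
proof -
  have "0 < 2 * threshold_weight" using threshold_pos by simp
  then obtain U where light: "U \<subseteq> sides" "sum weight U < 2 * threshold_weight"
    and expander: "expander (crossing R V) (sides - U) weight 2 (2 * threshold_weight)"
    using obtain_expander[OF finite_sides, of "2 * threshold_weight" weight 2 "crossing R V"]
      heavy_set_expands[OF size] by auto
  have "V b \<subseteq> {r \<in> V b. branches h b r} \<union> (U \<inter> V b)"
    using branches_if_expander[OF expander _ _ _ scale] by blast
  then have "card (V b) \<le> card ({r \<in> V b. branches h b r} \<union> (U \<inter> V b))"
    using finite_side by (intro card_mono) auto
  also have "\<dots> \<le> card {r \<in> V b. branches h b r} + card (U \<inter> V b)" by (rule card_Un_le)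
  finally have "card (V b) \<le> card {r \<in> V b. branches h b r} + card (U \<inter> V b)" .
  moreover have "k (\<not> b) * card (U \<inter> V b) < k (\<not> b) * (2 * k b)"
    using sum_weight[OF light(1), of b] light(2) unfolding threshold_weight_eq[of b]
    by (simp only: mult_ac)
  ultimately show ?thesis by simp
qed

lemma few_nonneighbours_in_side:
  assumes "X \<subseteq> V c" "k c \<le> card X"
  shows "card (nonneighbours R X (V (\<not> c)) \<inter> V b) < k b"
proof (cases "b = c")
  case True
  then have "nonneighbours R X (V (\<not> c)) \<inter> V b = {}"
    using sides_disjoint[of c] by (auto simp: nonneighbours_def)
  then show ?thesis using threshold_pos by simp
next
  case False
  then have "b = (\<not> c)" by auto
  moreover have "nonneighbours R X (V (\<not> c)) \<inter> V (\<not> c) = nonneighbours R X (V (\<not> c))"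
    by (auto simp: nonneighbours_def)
  ultimately show ?thesis using few_nonneighbours[OF assms] by simp
qed

text \<open>The connecting path runs inside the vertices of \<open>P\<close> that have a neighbour in each of \<open>X\<close> and
  \<open>Y\<close> lying opposite to them.\<close>

lemma connecting_path:
  assumes middle: "\<And>b. P b \<subseteq> V b" "\<And>b. 4 * k b + L \<le> card (P b)"
    and order: "0 < L" "odd L = (c = d)"
    and X_large: "X \<subseteq> V c" "k c \<le> card X" and Y_large: "Y \<subseteq> V d" "k d \<le> card Y"
  obtains x y u v where "x \<in> X" "y \<in> Y" "R x u" "R v y" "path_of_order R (\<Union>b. P b) L u v"
proof -
  define ZX where "ZX = nonneighbours R X (V (\<not> c))"
  define ZY where "ZY = nonneighbours R Y (V (\<not> d))"
  define P' where "P' b = P b - ZX - ZY" for b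
  have P'V: "P' b \<subseteq> V b" for b using middle(1) by (auto simp: P'_def)
  interpret P': joined_pair R P' k
    using P'V by (rule joined_pair_subset[OF joined_pair_axioms])
  have few: "card (ZX \<inter> V b) < k b" "card (ZY \<inter> V b) < k b" for b
    unfolding ZX_def ZY_def using X_large Y_large by (simp_all add: few_nonneighbours_in_side)
  have "2 * k b + L \<le> card (P' b)" for b
  proof -
    have "card (P b) \<le> card (P' b \<union> (ZX \<inter> V b) \<union> (ZY \<inter> V b))"
      using middle(1)[of b] finite_side P'.finite_side by (intro card_mono) (auto simp: P'_def)
    also have "\<dots> \<le> card (P' b) + card (ZX \<inter> V b) + card (ZY \<inter> V b)"
      by (meson card_Un_le add_le_mono1 le_trans)
    finally show ?thesis using middle(2)[of b] few[of b] by linarith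
  qed
  then obtain u v where first: "u \<in> P' (\<not> c)" and last: "v \<in> P' ((\<not> c) = odd L)"
    and path: "path_of_order R (\<Union>b. P' b) L u v"
    using order(1) by (rule P'.path_of_every_order)
  have "v \<in> P' (\<not> d)"
  proof -
    have "((\<not> c) = odd L) = (\<not> d)" using order(2) by auto
    with last show ?thesis by simp
  qed
  then obtain y where "y \<in> Y" "R v y"
    using P'V sympD[OF sym] by (auto simp: P'_def ZY_def nonneighbours_def)
  moreover obtain x where "x \<in> X" "R x u"
    using first P'V by (auto simp: P'_def ZX_def nonneighbours_def)
  moreover have "path_of_order R (\<Union>b. P b) L u v"
    using path by (rule path_of_order_mono) (auto simp: P'_def)
  ultimately show ?thesis by (intro that)
qed

lemma path_between_branching:
  assumes S_subset: "\<And>c. S c \<subseteq> V c" and T_subset: "\<And>c. T c \<subseteq> V c" and P_subset: "\<And>c. P c \<subseteq> V c"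
    and disj: "\<And>c. S c \<inter> T c = {}" "\<And>c. S c \<inter> P c = {}" "\<And>c. T c \<inter> P c = {}"
    and size: "\<And>c. 4 * k c + l \<le> card (P c)"
    and branches_a: "joined_pair.branches R S k h True a"
    and branches_b: "joined_pair.branches R T k h False b"
    and order: "even l" "2 * h + 3 \<le> l"
  shows "path_of_order R sides l a b"
proof -
  interpret S: joined_pair R S k using S_subset by (rule joined_pair_subset[OF joined_pair_axioms])
  interpret T: joined_pair R T k using T_subset by (rule joined_pair_subset[OF joined_pair_axioms])
  obtain d X where layer_a: "d \<le> h" "X \<subseteq> S (even d)" "k (even d) \<le> card X"
    and pathX: "\<And>x. x \<in> X \<Longrightarrow> path_of_order R S.sides (Suc d) a x"
    using branches_a by (auto simp: S.branches_def)
  obtain e Y where layer_b: "e \<le> h" "Y \<subseteq> T (odd e)" "k (odd e) \<le> card Y"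
    and pathY: "\<And>y. y \<in> Y \<Longrightarrow> path_of_order R T.sides (Suc e) b y"
    using branches_b by (auto simp: T.branches_def)
  define L where "L = l - Suc d - Suc e"
  have middle_order: "0 < L" "l = Suc d + L + Suc e"
    using order(2) layer_a(1) layer_b(1) by (auto simp: L_def)
  obtain x y u v where ends: "x \<in> X" "y \<in> Y" "R x u" "R v y"
      and path: "path_of_order R (\<Union>c. P c) L u v"
  proof (rule connecting_path[OF P_subset])
    show "4 * k c + L \<le> card (P c)" for c using size[of c] middle_order(2) by linarith
    show "odd L = (even d = odd e)" using order(1) middle_order(2) by auto
    show "X \<subseteq> V (even d)" "Y \<subseteq> V (odd e)" using layer_a(2) layer_b(2) S_subset T_subset by blast+
  qed (use middle_order(1) layer_a(3) layer_b(3) in auto)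
  have across: "A c \<inter> B e = {}"
    if "\<And>c. A c \<subseteq> V c" "\<And>c. B c \<subseteq> V c" "\<And>c. A c \<inter> B c = {}" for A B c e
    using that(1,2)[of c] that(1,2)[of e] that(3)[of c] sides_disjoint[of c] by (cases "e = c") auto
  have "S c \<inter> P e = {}" "S c \<inter> T e = {}" "T c \<inter> P e = {}" for c e
    using across[OF S_subset P_subset disj(2)] across[OF S_subset T_subset disj(1)]
      across[OF T_subset P_subset disj(3)] by auto
  then have disj_sides: "S.sides \<inter> (\<Union>c. P c) = {}" "(S.sides \<union> (\<Union>c. P c)) \<inter> T.sides = {}"
    by blast+
  have "path_of_order R (S.sides \<union> (\<Union>c. P c)) (Suc d + L) a v"
    using pathX[OF ends(1)] ends(3) path disj_sides(1) by (rule path_of_order_append)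
  then have "path_of_order R (S.sides \<union> (\<Union>c. P c) \<union> T.sides) (Suc d + L + Suc e) a b"
    using ends(4) path_of_order_sym[OF sym pathY[OF ends(2)]] disj_sides(2)
    by (rule path_of_order_append)
  moreover have "S.sides \<union> (\<Union>c. P c) \<union> T.sides \<subseteq> sides"
    by (intro Un_least UN_mono order_refl S_subset T_subset P_subset)
  ultimately show ?thesis unfolding middle_order(2) by (rule path_of_order_mono)
qed

lemma paths_of_every_even_order:
  assumes size: "\<And>c. 25 * k c \<le> card (V c)" and scale: "\<And>c. 2 * k c \<le> 3 ^ h"
  obtains A B where "A \<subseteq> V True" "B \<subseteq> V False" "k True \<le> card A" "k False \<le> card B"
    "\<And>a b l. a \<in> A \<Longrightarrow> b \<in> B \<Longrightarrow> even l \<Longrightarrow> 2 * h + 3 \<le> l \<Longrightarrow> (\<And>c. l \<le> k c) \<Longrightarrow>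
       path_of_order R sides l a b"
proof -
  have "\<exists>S T P. S \<subseteq> V c \<and> T \<subseteq> V c \<and> P \<subseteq> V c \<and> S \<inter> T = {} \<and> S \<inter> P = {} \<and> T \<inter> P = {} \<and>
      card S = 10 * k c \<and> card T = 10 * k c \<and> card P = 5 * k c" for c
    by (rule obtain_three_disjoint_subsets[OF finite_side, of "10 * k c" "10 * k c" "5 * k c" c])
       (use size[of c] in auto)
  then obtain S T P where S: "\<And>c. S c \<subseteq> V c" "\<And>c. card (S c) = 10 * k c"
    and T: "\<And>c. T c \<subseteq> V c" "\<And>c. card (T c) = 10 * k c"
    and P: "\<And>c. P c \<subseteq> V c" "\<And>c. card (P c) = 5 * k c"
    and disj: "\<And>c. S c \<inter> T c = {}" "\<And>c. S c \<inter> P c = {}" "\<And>c. T c \<inter> P c = {}"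
    by metis
  interpret S: joined_pair R S k using S(1) by (rule joined_pair_subset[OF joined_pair_axioms])
  interpret T: joined_pair R T k using T(1) by (rule joined_pair_subset[OF joined_pair_axioms])
  define A where "A = {a \<in> S True. S.branches h True a}"
  define B where "B = {b \<in> T False. T.branches h False b}"
  show ?thesis
  proof (rule that[of A B])
    show "A \<subseteq> V True" "B \<subseteq> V False" using S(1) T(1) by (auto simp: A_def B_def)
    show "k True \<le> card A" using S.many_branching[of True h] S(2) scale by (simp add: A_def)
    show "k False \<le> card B" using T.many_branching[of False h] T(2) scale by (simp add: B_def)
    fix a b l assume "a \<in> A" "b \<in> B" "even l" "2 * h + 3 \<le> l" "\<And>c. l \<le> k c"
    then show "path_of_order R sides l a b"
      using P(2) by (intro path_between_branching[OF S(1) T(1) P(1) disj]) (auto simp: A_def B_def)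
  qed
qed

end

section \<open>Closed walks\<close>

definition closed_walk :: "('a \<Rightarrow> 'a \<Rightarrow> bool) \<Rightarrow> 'a list \<Rightarrow> bool" where
  "closed_walk R xs \<longleftrightarrow> xs \<noteq> [] \<and> successively R xs \<and> R (last xs) (hd xs)"

definition contains_cycle :: "('a \<Rightarrow> 'a \<Rightarrow> bool) \<Rightarrow> nat \<Rightarrow> bool" where
  "contains_cycle R l \<longleftrightarrow> (\<exists>xs. length xs = l \<and> distinct xs \<and> closed_walk R xs)"

lemma closed_walk_mono:
  assumes "closed_walk G xs" "\<And>x y. x \<in> set xs \<Longrightarrow> y \<in> set xs \<Longrightarrow> G x y \<Longrightarrow> H x y"
  shows "closed_walk H xs"
  using assms unfolding closed_walk_def by (auto intro: successively_mono)

lemma closed_walk_rotate: "closed_walk G (as @ bs) \<Longrightarrow> closed_walk G (bs @ as)"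
  by (cases "as = []"; cases "bs = []") (auto simp: closed_walk_def successively_append_iff)

lemma closed_walk_two_neighbours:
  assumes "closed_walk G xs" "distinct xs" "3 \<le> length xs" "x \<in> set xs" and sym: "symp G"
  obtains y z where "y \<noteq> z" "G x y" "G x z"
proof -
  obtain as bs where xs: "xs = as @ x # bs" using assms(4) by (meson split_list)
  have "2 \<le> length (bs @ as)" using assms(3) by (simp add: xs)
  then obtain y ms z where yz: "bs @ as = y # ms @ [z]"
    by (cases "bs @ as"; cases "tl (bs @ as)" rule: rev_cases) (auto simp del: append_is_Nil_conv)
  have "closed_walk G (x # bs @ as)"
    using closed_walk_rotate[of G as "x # bs"] assms(1) by (simp add: xs)
  then have "G x y" "G z x" by (auto simp: yz closed_walk_def)
  moreover have "distinct (bs @ as)" using assms(2) by (auto simp: xs)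
  then have "y \<noteq> z" by (auto simp: yz)
  ultimately show ?thesis using that sympD[OF sym] by blast
qed

lemma odd_closed_walk_imp_odd_cycle:
  assumes "closed_walk G xs" "odd (length xs)"
  shows "\<exists>ys. closed_walk G ys \<and> odd (length ys) \<and> distinct ys \<and> set ys \<subseteq> set xs"
  using assms
proof (induction "length xs" arbitrary: xs rule: less_induct)
  case less
  show ?case
  proof (cases "distinct xs")
    case False
    then obtain as bs cs y where xs: "xs = as @ [y] @ bs @ [y] @ cs"
      using not_distinct_decomp by blast
    have "closed_walk G ((y # bs) @ (y # cs @ as))"
      using closed_walk_rotate[of G as "y # bs @ y # cs"] less.prems(1) by (simp add: xs)
    then have loops: "closed_walk G (y # bs)" "closed_walk G (y # cs @ as)"
      unfolding closed_walk_def successively_append_iff by auto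
    have "odd (length (y # bs)) \<or> odd (length (y # cs @ as))" using less.prems(2) by (auto simp: xs)
    then show ?thesis
    proof
      assume "odd (length (y # bs))"
      from less.hyps[OF _ loops(1) this] show ?thesis by (auto simp: xs)
    next
      assume "odd (length (y # cs @ as))"
      from less.hyps[OF _ loops(2) this] show ?thesis by (auto simp: xs)
    qed
  qed (use less.prems in blast)
qed

lemma relpowp_loop_imp_closed_walk:
  assumes "(G ^^ n) v v" "0 < n"
  obtains xs where "closed_walk G xs" "length xs = n"
proof -
  obtain f where walk: "f 0 = v" "f n = v" "\<And>i. i < n \<Longrightarrow> G (f i) (f (Suc i))"
    using assms(1) by (auto simp: relpowp_fun_conv)
  obtain m where n_eq: "n = Suc m" using assms(2) by (cases n) auto
  have "closed_walk G (map f [0..<n])"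
    unfolding closed_walk_def
  proof (intro conjI)
    show "successively G (map f [0..<n])" unfolding successively_conv_nth using walk(3) by auto
    show "G (last (map f [0..<n])) (hd (map f [0..<n]))"
      using walk(1,2) walk(3)[of m] by (simp add: n_eq hd_map last_map del: upt_Suc)
  qed (use n_eq in simp)
  then show ?thesis using that by simp
qed

lemma symp_relpowp:
  assumes "symp G" "(G ^^ n) x y"
  shows "(G ^^ n) y x"
  using assms(2)
proof (induction n arbitrary: y)
  case (Suc n)
  then obtain z where "(G ^^ n) x z" "G z y" by auto
  then have "G y z" "(G ^^ n) z x" using Suc.IH sympD[OF assms(1)] by auto
  then show ?case by (rule relpowp_Suc_I2)
qed simp

text \<open>A vertex is coloured by the parity of a walk to it from the representative of its component.\<close>

lemma two_colouring_if_no_odd_closed_walk: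
  assumes sym: "symp G" and no_odd: "\<And>xs. closed_walk G xs \<Longrightarrow> even (length xs)"
  obtains c :: "'a \<Rightarrow> bool" where "\<And>u v. G u v \<Longrightarrow> c u \<noteq> c v"
proof -
  define root where "root v = (SOME u. G\<^sup>*\<^sup>* u v)" for v
  have reachable: "G\<^sup>*\<^sup>* (root v) v" for v unfolding root_def by (rule someI[of _ v]) simp
  have root_eq: "root u = root v" if "G u v" for u v
  proof -
    have "G\<^sup>*\<^sup>* x u \<longleftrightarrow> G\<^sup>*\<^sup>* x v" for x
      using that sympD[OF sym that] by (auto intro: rtranclp.rtrancl_into_rtrancl)
    then show ?thesis by (simp add: root_def)
  qed
  define c where "c v \<longleftrightarrow> (\<exists>n. even n \<and> (G ^^ n) (root v) v)" for v
  have ex_walk: "\<exists>n. even n = c v \<and> (G ^^ n) (root v) v" for v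
    using rtranclp_imp_relpowp[OF reachable[of v]] unfolding c_def by metis
  have "c u \<noteq> c v" if uv: "G u v" for u v
  proof
    assume same_colour: "c u = c v"
    obtain m where walk_u: "even m = c u" "(G ^^ m) (root u) u" using ex_walk by blast
    obtain n where walk_v: "even n = c v" "(G ^^ n) (root u) v"
      using ex_walk root_eq[OF uv] by metis
    have "(G ^^ Suc m) (root u) v" using walk_u(2) uv by auto
    from relpowp_trans[OF this symp_relpowp[OF sym walk_v(2)]]
    obtain xs where "closed_walk G xs" "length xs = Suc m + n"
      by (rule relpowp_loop_imp_closed_walk) simp
    then show False using no_odd[of xs] walk_u(1) walk_v(1) same_colour by auto
  qed
  then show ?thesis by (rule that)
qed

lemma odd_cycle_or_independent_half:
  assumes sym: "symp G" and field: "\<forall>i j. G i j \<longrightarrow> i \<in> I \<and> j \<in> I"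
  obtains (odd_cycle) xs where "closed_walk G xs" "odd (length xs)" "distinct xs" "set xs \<subseteq> I"
  | (independent) J where "J \<subseteq> I" "card I \<le> 2 * card J" "\<And>i j. i \<in> J \<Longrightarrow> j \<in> J \<Longrightarrow> \<not> G i j"
proof (cases "\<exists>xs. closed_walk G xs \<and> odd (length xs)")
  case True
  then obtain xs where xs: "closed_walk G xs" "odd (length xs)" "distinct xs"
    using odd_closed_walk_imp_odd_cycle by blast
  have "set xs \<subseteq> I"
  proof
    fix x assume "x \<in> set xs"
    then obtain as bs where "xs = as @ x # bs" by (meson split_list)
    then have "closed_walk G (x # bs @ as)" using closed_walk_rotate[of G as "x # bs"] xs(1) by simp
    then show "x \<in> I" using field by (auto simp: closed_walk_def)
  qed
  with xs show ?thesis by (rule odd_cycle)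
next
  case False
  then obtain c :: "'a \<Rightarrow> bool" where c: "\<And>u v. G u v \<Longrightarrow> c u \<noteq> c v"
    using two_colouring_if_no_odd_closed_walk[OF sym] by blast
  define J where "J b = {v \<in> I. c v = b}" for b
  have "card I = card (J True \<union> J False)" by (rule arg_cong[where f = card]) (auto simp: J_def)
  also have "\<dots> \<le> card (J True) + card (J False)" by (rule card_Un_le)
  finally have "card I \<le> 2 * card (J True) \<or> card I \<le> 2 * card (J False)" by linarith
  then obtain b where "card I \<le> 2 * card (J b)" by blast
  then show ?thesis using c by (intro independent[of "J b"]) (auto simp: J_def)
qed

section \<open>Cycles through joined clusters\<close>

lemma joined_transversal:
  assumes "successively (\<lambda>i j. joined R (X i) (k i) (X j) (k j)) (p # ms @ [q])"
    and "\<And>i. i \<in> set ms \<Longrightarrow> finite (X i) \<and> 2 * k i \<le> card (X i)"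
    and "S \<subseteq> X p" "k p \<le> card S" and last_set: "T \<subseteq> X q" "k q \<le> card T"
  shows "\<exists>a mid b. a \<in> S \<and> b \<in> T \<and> list_all2 (\<lambda>v i. v \<in> X i) mid ms \<and>
           successively R (a # mid @ [b])"
  using assms(1-4)
proof (induction ms arbitrary: p S)
  case Nil
  then have "\<not> edge_free R S T" using last_set by (auto simp: joined_def)
  then obtain a b where "a \<in> S" "b \<in> T" "R a b" by (auto simp: edge_free_def)
  then show ?case by (intro exI[of _ a] exI[of _ "[]"] exI[of _ b]) simp
next
  case (Cons m ms)
  define S' where "S' = {y \<in> X m. \<exists>x\<in>S. R x y}"
  have cluster: "finite (X m)" "2 * k m \<le> card (X m)" using Cons.prems(2) by auto
  have "card (nonneighbours R S (X m)) < k m"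
    using Cons.prems(1,3,4) by (intro joined_imp_few_nonneighbours[of R "X p" "k p"]) auto
  moreover have "card (X m) \<le> card (S' \<union> nonneighbours R S (X m))"
    using cluster(1) by (intro card_mono) (auto simp: S'_def nonneighbours_def)
  ultimately have "k m \<le> card S'"
    using cluster(2) card_Un_le[of S' "nonneighbours R S (X m)"] by linarith
  moreover have "S' \<subseteq> X m" by (auto simp: S'_def)
  ultimately obtain a mid b where IH: "a \<in> S'" "b \<in> T" "list_all2 (\<lambda>v i. v \<in> X i) mid ms"
      "successively R (a # mid @ [b])"
    using Cons.IH[of m S'] Cons.prems(1,2) by auto
  obtain x where "x \<in> S" "R x a" "a \<in> X m" using IH(1) by (auto simp: S'_def)
  then show ?case
    using IH by (intro exI[of _ x] exI[of _ "a # mid"] exI[of _ b]) simp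
qed

lemma distinct_transversal:
  assumes "list_all2 (\<lambda>v i. v \<in> X i) vs cs" "distinct cs" "disjoint_family_on X (set cs)"
  shows "distinct vs"
  unfolding distinct_conv_nth
proof (intro allI impI)
  fix a b assume indices: "a < length vs" "b < length vs" "a \<noteq> b"
  then have "vs ! a \<in> X (cs ! a)" "vs ! b \<in> X (cs ! b)" "length vs = length cs"
    using assms(1) by (auto simp: list_all2_conv_all_nth)
  moreover from this have "X (cs ! a) \<inter> X (cs ! b) = {}"
    using indices assms(2)
    by (intro disjoint_family_onD[OF assms(3)]) (auto simp: nth_eq_iff_index_eq)
  ultimately show "vs ! a \<noteq> vs ! b" by auto
qed

lemma set_transversal_subset:
  assumes "list_all2 (\<lambda>v i. v \<in> X i) vs cs"
  shows "set vs \<subseteq> (\<Union>i\<in>set cs. X i)"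
  using assms by induction auto

lemma path_between_joined_sets:
  assumes sym: "symp R" and fin: "finite A" "finite B" and disj: "A \<inter> B = {}"
    and joined: "joined R A k B m" and order: "even l" "2 * h + 3 \<le> l" "l \<le> k" "l \<le> m"
    and size: "25 * k \<le> card A" "25 * m \<le> card B" and scale: "2 * k \<le> 3 ^ h" "2 * m \<le> 3 ^ h"
  obtains A' B' where "A' \<subseteq> A" "B' \<subseteq> B" "k \<le> card A'" "m \<le> card B'"
    "\<And>a b. a \<in> A' \<Longrightarrow> b \<in> B' \<Longrightarrow> path_of_order R (A \<union> B) l a b"
proof -
  define V where "V c = (if c then A else B)" for c
  define \<kappa> where "\<kappa> c = (if c then k else m)" for c
  have V: "V True = A" "V False = B" "(\<Union>c. V c) = A \<union> B" and \<kappa>: "\<kappa> True = k" "\<kappa> False = m"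
    by (auto simp: V_def \<kappa>_def UNIV_bool)
  interpret joined_pair R V \<kappa>
  proof
    show "joined R (V c) (\<kappa> c) (V (\<not> c)) (\<kappa> (\<not> c))" for c
      using joined joined_sym[OF sym joined] by (simp add: V_def \<kappa>_def)
  qed (use sym fin disj order in \<open>auto simp: V_def \<kappa>_def\<close>)
  obtain A' B' where AB: "A' \<subseteq> V True" "B' \<subseteq> V False" "\<kappa> True \<le> card A'" "\<kappa> False \<le> card B'"
    and paths: "\<And>a b l. a \<in> A' \<Longrightarrow> b \<in> B' \<Longrightarrow> even l \<Longrightarrow> 2 * h + 3 \<le> l \<Longrightarrow> (\<And>c. l \<le> \<kappa> c) \<Longrightarrow>
                  path_of_order R sides l a b"
    by (rule paths_of_every_even_order[of h]) (use size scale in \<open>auto simp: V_def \<kappa>_def\<close>)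
  show ?thesis
  proof (rule that)
    show "path_of_order R (A \<union> B) l a b" if "a \<in> A'" "b \<in> B'" for a b
      using paths[OF that order(1,2)] order(3,4) by (simp add: V \<kappa>_def)
  qed (use AB in \<open>simp_all add: V \<kappa>\<close>)
qed

lemma contains_cycle_if_path_and_detour:
  assumes sym: "symp R" and path: "path_of_order R W l a b"
    and detour: "successively R (a # mid @ [b])" "distinct mid" "set mid \<inter> W = {}"
  shows "contains_cycle R (l + length mid)"
proof -
  obtain xs where xs: "xs \<noteq> []" "length xs = l" "hd xs = a" "last xs = b" "distinct xs"
      "successively R xs" "set xs \<subseteq> W"
    using path by (auto simp: path_of_order_def)
  have "successively R (rev (a # mid @ [b]))"
    unfolding successively_rev using detour(1) by (rule successively_mono) (rule sympD[OF sym])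
  then have "successively R (b # rev mid @ [a])" by simp
  then have "closed_walk R (xs @ rev mid)"
    using xs unfolding closed_walk_def
    by (cases "rev mid" rule: rev_cases)
       (auto simp: successively_append_iff successively_Cons hd_append split: if_splits)
  then show ?thesis
    unfolding contains_cycle_def using xs detour by (intro exI[of _ "xs @ rev mid"]) auto
qed

text \<open>Only the two clusters that carry the long path need the factor 25; the others are crossed
  once.\<close>

lemma cluster_cycle:
  fixes X :: "'i \<Rightarrow> 'a set"
  assumes sym: "symp R"
    and clusters: "distinct cs" "2 \<le> length cs" "disjoint_family_on X (set cs)"
    and joined: "closed_walk (\<lambda>i j. joined R (X i) (k i) (X j) (k j)) cs"
    and size: "\<And>i. i \<in> set cs \<Longrightarrow> finite (X i) \<and> 2 * k i \<le> card (X i)"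
    and core: "\<And>i. i \<in> {hd cs, last cs} \<Longrightarrow> 25 * k i \<le> card (X i) \<and> l \<le> k i \<and> 2 * k i \<le> 3 ^ h"
    and order: "even (l + length cs)" "2 * h + 3 + length cs \<le> l"
  shows "contains_cycle R l"
proof -
  obtain p ms q where cs_eq: "cs = p # ms @ [q]"
    using clusters(2) by (cases cs; cases "tl cs" rule: rev_cases) auto
  define l' where "l' = l - length ms"
  have path_order: "even l'" "2 * h + 3 \<le> l'" "l = l' + length ms"
    using order by (auto simp: l'_def cs_eq)
  have disj: "X p \<inter> X q = {}" using clusters by (auto simp: cs_eq disjoint_family_on_def)
  have joined_pq: "joined R (X p) (k p) (X q) (k q)"
    using joined joined_sym[OF sym] by (simp add: closed_walk_def cs_eq)
  obtain A B where A: "A \<subseteq> X p" "k p \<le> card A" and B: "B \<subseteq> X q" "k q \<le> card B"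
    and path: "\<And>a b. a \<in> A \<Longrightarrow> b \<in> B \<Longrightarrow> path_of_order R (X p \<union> X q) l' a b"
    by (rule path_between_joined_sets[OF sym _ _ disj joined_pq path_order(1,2)])
       (use size core[of p] core[of q] path_order(3) in \<open>auto simp: cs_eq\<close>)
  obtain a mid b where ends: "a \<in> A" "b \<in> B" and mid: "list_all2 (\<lambda>v i. v \<in> X i) mid ms"
    and detour: "successively R (a # mid @ [b])"
    using joined_transversal[of R X k p ms q A B] joined size A B
    by (auto simp: closed_walk_def cs_eq)
  have "distinct mid"
    using mid clusters
    by (intro distinct_transversal[OF mid]) (auto simp: cs_eq disjoint_family_on_def)
  moreover have "set mid \<inter> (X p \<union> X q) = {}"
    using set_transversal_subset[OF mid] clusters by (fastforce simp: cs_eq disjoint_family_on_def)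
  ultimately have "contains_cycle R (l' + length mid)"
    using detour by (intro contains_cycle_if_path_and_detour[OF sym path[OF ends]])
  then show ?thesis using list_all2_lengthD[OF mid] path_order(3) by simp
qed

section \<open>Eliminating one colour\<close>

lemma edge_free_subpair:
  assumes sym: "symp R" and no_cycle: "\<not> contains_cycle R l"
    and len: "even l" "2 * h + 5 \<le> l" "l \<le> k" "2 * k \<le> 3 ^ h"
    and fin: "finite A" "finite B" and disj: "A \<inter> B = {}"
    and size: "25 * k \<le> card A" "25 * k \<le> card B"
  obtains X Y where "X \<subseteq> A" "Y \<subseteq> B" "card X = k" "card Y = k" "edge_free R X Y"
proof (rule not_joined_imp_edge_free)
  show "\<not> joined R A k B k"
  proof
    assume joined: "joined R A k B k"
    have "A \<noteq> B" using disj size len by auto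
    have "contains_cycle R l"
    proof (rule cluster_cycle[OF sym, of "[A, B]" "\<lambda>S. S" "\<lambda>_. k" l h])
      show "closed_walk (\<lambda>S T. joined R S k T k) [A, B]"
        using joined joined_sym[OF sym joined] by (simp add: closed_walk_def)
    qed (use \<open>A \<noteq> B\<close> fin disj size len in \<open>auto simp: disjoint_family_on_def\<close>)
    with no_cycle show False by simp
  qed
qed (rule that)

lemma edge_free_pair_within:
  assumes sym: "symp R" and no_cycle: "\<not> contains_cycle R l"
    and len: "2 * h + 6 \<le> l" "l \<le> k" "2 * k \<le> 3 ^ h"
    and fin: "finite V" and size: "52 * k \<le> card V"
  obtains X Y where "X \<subseteq> V" "Y \<subseteq> V" "X \<inter> Y = {}" "card X = k" "card Y = k" "edge_free R X Y"
proof -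
  obtain A B C where ABC: "A \<subseteq> V" "B \<subseteq> V" "C \<subseteq> V" "A \<inter> B = {}" "A \<inter> C = {}" "B \<inter> C = {}"
      and card: "card A = 25 * k" "card B = 25 * k" "card C = 2 * k"
    by (rule obtain_three_disjoint_subsets[OF fin, of "25 * k" "25 * k" "2 * k"]) (use size in auto)
  have fin3: "finite A" "finite B" "finite C" using ABC fin by (auto intro: finite_subset)
  have distinct: "A \<noteq> B" "A \<noteq> C" "B \<noteq> C" using ABC card len by auto
  have "\<not> (joined R A k B k \<and> joined R A k C k \<and> joined R B k C k)"
  proof
    assume "joined R A k B k \<and> joined R A k C k \<and> joined R B k C k"
    then have joined: "joined R A k B k" "joined R A k C k" "joined R B k C k" by auto
    define cs where "cs = (if even l then [A, B] else [A, C, B])"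
    have cs: "distinct cs" "2 \<le> length cs" "length cs \<le> 3" "even (l + length cs)"
      "set cs \<subseteq> {A, B, C}" "{hd cs, last cs} = {A, B}"
      using distinct by (auto simp: cs_def)
    have "contains_cycle R l"
    proof (rule cluster_cycle[OF sym cs(1,2), of "\<lambda>S. S" "\<lambda>_. k" l h])
      show "closed_walk (\<lambda>S T. joined R S k T k) cs"
        using joined joined[THEN joined_sym[OF sym]] by (simp add: closed_walk_def cs_def)
      have "disjoint_family_on (\<lambda>S. S) {A, B, C}" using ABC by (auto simp: disjoint_family_on_def)
      then show "disjoint_family_on (\<lambda>S. S) (set cs)"
        using cs(5) by (rule disjoint_family_on_mono[rotated])
      show "finite S \<and> 2 * k \<le> card S" if "S \<in> set cs" for S using that cs(5) fin3 card by auto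
      show "25 * k \<le> card S \<and> l \<le> k \<and> 2 * k \<le> 3 ^ h" if "S \<in> {hd cs, last cs}" for S
        using that card len unfolding cs(6) by auto
    qed (use cs(3,4) len in auto)
    with no_cycle show False by simp
  qed
  then obtain S T where ST: "S \<subseteq> V" "T \<subseteq> V" "S \<inter> T = {}" and not_joined: "\<not> joined R S k T k"
    using ABC by blast
  obtain X Y where "X \<subseteq> S" "Y \<subseteq> T" "card X = k" "card Y = k" "edge_free R X Y"
    using not_joined by (rule not_joined_imp_edge_free)
  with ST show ?thesis by (intro that[of X Y]) auto
qed

definition edge_free_family :: "('a \<Rightarrow> 'a \<Rightarrow> bool) \<Rightarrow> 'a set \<Rightarrow> nat \<Rightarrow> 'a set set \<Rightarrow> bool" where
  "edge_free_family R V k \<Z> \<longleftrightarrow>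
     (\<forall>Z\<in>\<Z>. Z \<subseteq> V \<and> card Z = k) \<and> pairwise (\<lambda>X Y. X \<inter> Y = {} \<and> edge_free R X Y) \<Z>"

lemma edge_free_family_Un:
  assumes sym: "symp R" and pair: "X \<subseteq> V" "Y \<subseteq> V" "X \<inter> Y = {}" "edge_free R X Y"
    and families: "edge_free_family R X k \<X>" "edge_free_family R Y k \<Y>"
  shows "edge_free_family R V k (\<X> \<union> \<Y>)"
proof -
  have members: "\<forall>Z\<in>\<X>. Z \<subseteq> X \<and> card Z = k" "\<forall>Z\<in>\<Y>. Z \<subseteq> Y \<and> card Z = k"
    and pairwise: "pairwise (\<lambda>X Y. X \<inter> Y = {} \<and> edge_free R X Y) \<X>"
      "pairwise (\<lambda>X Y. X \<inter> Y = {} \<and> edge_free R X Y) \<Y>"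
    using families by (simp_all add: edge_free_family_def)
  have cross: "A \<inter> B = {} \<and> edge_free R A B \<and> edge_free R B A" if "A \<in> \<X>" "B \<in> \<Y>" for A B
  proof -
    have sub: "A \<subseteq> X" "B \<subseteq> Y" using members that by auto
    then have "edge_free R A B" by (rule edge_free_mono[OF pair(4)])
    then show ?thesis using sub pair(3) edge_free_sym[OF sym, of A B] by blast
  qed
  have "pairwise (\<lambda>X Y. X \<inter> Y = {} \<and> edge_free R X Y) (\<X> \<union> \<Y>)"
    using pairwise cross unfolding pairwise_def by blast
  moreover have "\<forall>Z\<in>\<X> \<union> \<Y>. Z \<subseteq> V \<and> card Z = k" using members pair(1,2) by blast
  ultimately show ?thesis by (simp add: edge_free_family_def)
qed

lemma edge_free_family_within:
  assumes sym: "symp R" and no_cycle: "\<not> contains_cycle R l" and len: "2 * h + 6 \<le> l" "l \<le> k"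
    and "finite V" "52 ^ d * k \<le> card V" "2 * (52 ^ d * k) \<le> 3 ^ h"
  shows "\<exists>\<Z>. card \<Z> = 2 ^ d \<and> edge_free_family R V k \<Z>"
  using assms(5-7)
proof (induction d arbitrary: V)
  case 0
  then obtain X where "X \<subseteq> V" "card X = k" using obtain_subset_with_card_n[of k V] by auto
  then show ?case by (intro exI[of _ "{X}"]) (simp add: edge_free_family_def)
next
  case (Suc d)
  have "l \<le> 52 ^ d * k" using len(2) by (rule order_trans) simp
  then obtain X Y where pair: "X \<subseteq> V" "Y \<subseteq> V" "X \<inter> Y = {}" "edge_free R X Y"
      and card: "card X = 52 ^ d * k" "card Y = 52 ^ d * k"
    by (rule edge_free_pair_within[OF sym no_cycle len(1)]) (use Suc.prems in auto)
  have "finite X" "finite Y" using pair(1,2) Suc.prems(1) by (auto intro: finite_subset)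
  then obtain \<X> \<Y> where card_families: "card \<X> = 2 ^ d" "card \<Y> = 2 ^ d"
      and families: "edge_free_family R X k \<X>" "edge_free_family R Y k \<Y>"
    using Suc.IH[of X] Suc.IH[of Y] card Suc.prems(3) by auto
  have "Z \<notin> \<Y>" if "Z \<in> \<X>" for Z
  proof
    assume "Z \<in> \<Y>"
    then have "Z \<subseteq> X" "Z \<subseteq> Y" "card Z = k" using families that by (auto simp: edge_free_family_def)
    moreover from this have "Z = {}" using pair(3) by blast
    ultimately show False using len by simp
  qed
  then have "card (\<X> \<union> \<Y>) = 2 ^ Suc d"
    using card_families by (subst card_Un_disjoint) (auto intro: card_ge_0_finite)
  moreover have "edge_free_family R V k (\<X> \<union> \<Y>)"
    using sym pair families by (rule edge_free_family_Un)
  ultimately show ?case by blast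
qed

definition complement_edge :: "'i set \<Rightarrow> ('i \<times> 'i) set \<Rightarrow> 'i \<Rightarrow> 'i \<Rightarrow> bool" where
  "complement_edge I \<Phi> i j \<longleftrightarrow> i \<in> I \<and> j \<in> I \<and> i \<noteq> j \<and> (i, j) \<notin> \<Phi>"

lemma symp_complement_edge: "sym \<Phi> \<Longrightarrow> symp (complement_edge I \<Phi>)"
  by (auto simp: symp_def complement_edge_def dest: symD)

text \<open>\<open>\<Phi>\<close> records the pairs of clusters that have already been made edge-free; a cluster lying in
  \<open>d\<close> of these pairs has been cut down to \<open>s d\<close> vertices.\<close>

definition separated :: "('a \<Rightarrow> 'a \<Rightarrow> bool) \<Rightarrow> ('i \<Rightarrow> 'a set) \<Rightarrow> (nat \<Rightarrow> nat) \<Rightarrow> 'i set \<Rightarrow>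
    ('i \<times> 'i) set \<Rightarrow> ('i \<Rightarrow> 'a set) \<Rightarrow> bool" where
  "separated R V s I \<Phi> Y \<longleftrightarrow> \<Phi> \<subseteq> I \<times> I \<and> sym \<Phi> \<and> irrefl \<Phi> \<and>
     (\<forall>i\<in>I. Y i \<subseteq> V i \<and> card (Y i) = s (card (\<Phi> `` {i}))) \<and>
     (\<forall>(i, j)\<in>\<Phi>. edge_free R (Y i) (Y j))"

lemma separated_empty:
  assumes "\<And>i. i \<in> I \<Longrightarrow> s 0 \<le> card (V i)"
  shows "\<exists>Y. separated R V s I {} Y"
proof -
  have "\<exists>X. X \<subseteq> V i \<and> card X = s 0" if "i \<in> I" for i
    using obtain_subset_with_card_n[OF assms[OF that]] by metis
  then obtain Y where "\<And>i. i \<in> I \<Longrightarrow> Y i \<subseteq> V i \<and> card (Y i) = s 0" by metis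
  then show ?thesis by (intro exI[of _ Y]) (auto simp: separated_def sym_def irrefl_def)
qed

lemma separated_insert:
  assumes sym: "symp R" and fin: "finite I" and sep: "separated R V s I \<Phi> Y"
    and edge: "complement_edge I \<Phi> i j"
    and not_joined: "\<not> joined R (Y i) (s (Suc (card (\<Phi> `` {i})))) (Y j) (s (Suc (card (\<Phi> `` {j}))))"
  shows "\<exists>Y'. separated R V s I (insert (i, j) (insert (j, i) \<Phi>)) Y'"
proof -
  let ?\<Psi> = "insert (i, j) (insert (j, i) \<Phi>)"
  have ij: "i \<in> I" "j \<in> I" "i \<noteq> j" "(i, j) \<notin> \<Phi>" using edge by (auto simp: complement_edge_def)
  obtain A B where AB: "A \<subseteq> Y i" "B \<subseteq> Y j" "card A = s (Suc (card (\<Phi> `` {i})))"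
      "card B = s (Suc (card (\<Phi> `` {j})))" "edge_free R A B"
    using not_joined by (rule not_joined_imp_edge_free)
  define Z where "Z = Y(i := A, j := B)"
  have shrunk: "Z m \<subseteq> Y m" for m using AB(1,2) by (auto simp: Z_def)
  have \<Phi>: "\<Phi> \<subseteq> I \<times> I" "sym \<Phi>" "irrefl \<Phi>"
      "\<And>m. m \<in> I \<Longrightarrow> Y m \<subseteq> V m \<and> card (Y m) = s (card (\<Phi> `` {m}))"
      "\<And>a b. (a, b) \<in> \<Phi> \<Longrightarrow> edge_free R (Y a) (Y b)"
    using sep by (auto simp: separated_def)
  have fin_nbrs: "finite (\<Phi> `` {m})" for m
    using \<Phi>(1) fin by (meson finite_Image finite_SigmaI finite_subset)
  have "(j, i) \<notin> \<Phi>" using ij(4) \<Phi>(2) by (auto dest: symD)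
  moreover have "?\<Psi> `` {i} = insert j (\<Phi> `` {i})" "?\<Psi> `` {j} = insert i (\<Phi> `` {j})"
    "\<And>m. m \<noteq> i \<Longrightarrow> m \<noteq> j \<Longrightarrow> ?\<Psi> `` {m} = \<Phi> `` {m}"
    using ij(3) by auto
  ultimately have "card (Z m) = s (card (?\<Psi> `` {m}))" if "m \<in> I" for m
    using \<Phi>(4)[OF that] AB(3,4) ij(3,4) fin_nbrs by (auto simp: Z_def)
  moreover have "Z m \<subseteq> V m" if "m \<in> I" for m using \<Phi>(4)[OF that] shrunk by blast
  moreover have "edge_free R (Z a) (Z b)" if "(a, b) \<in> \<Phi>" for a b
    using \<Phi>(5)[OF that] shrunk shrunk by (rule edge_free_mono)
  moreover have "edge_free R (Z i) (Z j)" "edge_free R (Z j) (Z i)"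
    using AB(5) edge_free_sym[OF sym AB(5)] ij(3) by (auto simp: Z_def)
  moreover have "sym ?\<Psi>" "irrefl ?\<Psi>" "?\<Psi> \<subseteq> I \<times> I"
    using \<Phi>(1-3) ij by (auto simp: sym_def irrefl_def)
  ultimately show ?thesis by (intro exI[of _ Z]) (auto simp: separated_def)
qed

lemma maximal_separated:
  assumes sym: "symp R" and fin: "finite I" and size: "\<And>i. i \<in> I \<Longrightarrow> s 0 \<le> card (V i)"
  obtains \<Phi> Y where "separated R V s I \<Phi> Y"
    "\<And>i j. complement_edge I \<Phi> i j \<Longrightarrow>
       joined R (Y i) (s (Suc (card (\<Phi> `` {i})))) (Y j) (s (Suc (card (\<Phi> `` {j}))))"
proof -
  let ?S = "{\<Phi>. \<exists>Y. separated R V s I \<Phi> Y}"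
  have "?S \<subseteq> Pow (I \<times> I)" by (auto simp: separated_def)
  then have "finite ?S" by (rule finite_subset) (use fin in simp)
  moreover have "{} \<in> ?S" using separated_empty[of I s V, OF size] by simp
  ultimately obtain \<Phi> where "\<Phi> \<in> ?S" and maximal: "\<forall>\<Psi>\<in>?S. \<Phi> \<subseteq> \<Psi> \<longrightarrow> \<Phi> = \<Psi>"
    using finite_has_maximal[of ?S] by blast
  then obtain Y where sep: "separated R V s I \<Phi> Y" by blast
  show ?thesis
  proof (rule that[OF sep], rule ccontr)
    fix i j assume edge: "complement_edge I \<Phi> i j"
      and not_joined:
        "\<not> joined R (Y i) (s (Suc (card (\<Phi> `` {i})))) (Y j) (s (Suc (card (\<Phi> `` {j}))))"
    let ?\<Psi> = "insert (i, j) (insert (j, i) \<Phi>)"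
    have "?\<Psi> \<in> ?S" using separated_insert[OF sym fin sep edge not_joined] by simp
    from bspec[OF maximal this] have "\<Phi> = ?\<Psi>" by blast
    then show False using edge by (auto simp: complement_edge_def)
  qed
qed

text \<open>Each vertex of the cycle has two neighbours outside \<open>\<Phi>\<close>.\<close>

lemma card_Image_on_complement_cycle:
  assumes fin: "finite I" and pairs: "\<Phi> \<subseteq> I \<times> I" "sym \<Phi>" "irrefl \<Phi>"
    and cycle: "closed_walk (complement_edge I \<Phi>) cs" "distinct cs" "3 \<le> length cs" "i \<in> set cs"
  shows "card (\<Phi> `` {i}) + 3 \<le> card I"
proof -
  obtain y z where yz: "y \<noteq> z" "complement_edge I \<Phi> i y" "complement_edge I \<Phi> i z"
    using cycle symp_complement_edge[OF pairs(2)] by (rule closed_walk_two_neighbours)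
  have "card (\<Phi> `` {i}) + card {i, y, z} = card (\<Phi> `` {i} \<union> {i, y, z})"
    using fin pairs(1,3) yz
    by (intro card_Un_disjoint[symmetric])
       (auto simp: complement_edge_def irrefl_def intro: finite_subset[of _ I])
  also have "\<dots> \<le> card I" using fin pairs(1) yz by (intro card_mono) (auto simp: complement_edge_def)
  also have "card {i, y, z} = 3" using yz by (auto simp: complement_edge_def)
  finally show ?thesis .
qed

lemma odd_closed_walk_irrefl_imp_length:
  assumes "closed_walk G xs" "odd (length xs)" "\<And>x. \<not> G x x"
  shows "3 \<le> length xs"
proof (rule ccontr)
  assume "\<not> ?thesis"
  moreover have "length xs \<noteq> 0" "length xs \<noteq> 2"
    using assms(2) by (metis even_zero, metis even_numeral)
  ultimately have "length xs = 1" by linarith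
  then obtain x where "xs = [x]" by (auto simp: length_Suc_conv)
  then show False using assms(1,3) by (simp add: closed_walk_def)
qed

text \<open>The function \<open>s\<close> used for \<open>2 * q + 1\<close> clusters. A cluster can lie in up to \<open>2 * q\<close>
  pairs, where the truncated subtraction leaves its size at \<open>k\<close>.\<close>

definition cluster_size :: "nat \<Rightarrow> nat \<Rightarrow> nat \<Rightarrow> nat" where
  "cluster_size q k d = 25 ^ (2 * q - 1 - d) * k"

lemma cluster_size_Suc:
  assumes "d + 2 \<le> 2 * q"
  shows "cluster_size q k d = 25 * cluster_size q k (Suc d)"
proof -
  have "2 * q - 1 - d = Suc (2 * q - 1 - Suc d)" using assms by linarith
  then show ?thesis by (simp add: cluster_size_def)
qed

lemma cluster_size_lower: "k \<le> cluster_size q k d"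
  by (simp add: cluster_size_def)

lemma cluster_size_upper: "cluster_size q k d \<le> cluster_size q k 0"
  unfolding cluster_size_def by (intro mult_le_mono1 power_increasing) auto

lemma separated_odd_cycle:
  assumes sym: "symp R" and fin: "finite I" and card: "card I = 2 * q + 1"
    and clusters: "\<And>i. i \<in> I \<Longrightarrow> finite (V i)" "disjoint_family_on V I"
    and sep: "separated R V (cluster_size q k) I \<Phi> Y"
    and joined: "\<And>i j. complement_edge I \<Phi> i j \<Longrightarrow>
       joined R (Y i) (cluster_size q k (Suc (card (\<Phi> `` {i}))))
         (Y j) (cluster_size q k (Suc (card (\<Phi> `` {j}))))"
    and cycle: "closed_walk (complement_edge I \<Phi>) cs" "odd (length cs)" "distinct cs" "set cs \<subseteq> I"
    and len: "odd l" "2 * h + 3 + card I \<le> l" "l \<le> k" "2 * cluster_size q k 0 \<le> 3 ^ h"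
  shows "contains_cycle R l"
proof -
  define \<kappa> where "\<kappa> i = cluster_size q k (Suc (card (\<Phi> `` {i})))" for i
  have pairs: "\<Phi> \<subseteq> I \<times> I" "sym \<Phi>" "irrefl \<Phi>"
    and Y: "\<And>i. i \<in> I \<Longrightarrow> Y i \<subseteq> V i \<and> card (Y i) = cluster_size q k (card (\<Phi> `` {i}))"
    using sep by (auto simp: separated_def)
  have cycle_len: "3 \<le> length cs" "length cs \<le> card I"
    using odd_closed_walk_irrefl_imp_length[OF cycle(1,2)] cycle(3,4) fin
    by (auto simp: complement_edge_def distinct_card[symmetric] intro: card_mono)
  have size: "finite (Y i) \<and> card (Y i) = 25 * \<kappa> i" if "i \<in> set cs" for i
  proof -
    have "card (\<Phi> `` {i}) + 2 \<le> 2 * q"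
      using card_Image_on_complement_cycle[OF fin pairs cycle(1,3) cycle_len(1) that] card by simp
    moreover have "i \<in> I" using that cycle(4) by blast
    ultimately show ?thesis
      using Y[of i] clusters(1)[of i] by (auto simp: \<kappa>_def cluster_size_Suc intro: finite_subset)
  qed
  have bounds: "l \<le> \<kappa> i \<and> 2 * \<kappa> i \<le> 3 ^ h" for i
  proof
    show "l \<le> \<kappa> i" unfolding \<kappa>_def using len(3) cluster_size_lower by (rule order_trans)
    show "2 * \<kappa> i \<le> 3 ^ h"
      unfolding \<kappa>_def using mult_le_mono2[OF cluster_size_upper] len(4) by (rule order_trans)
  qed
  show ?thesis
  proof (rule cluster_cycle[OF sym cycle(3), of Y \<kappa> l h])
    show "closed_walk (\<lambda>i j. joined R (Y i) (\<kappa> i) (Y j) (\<kappa> j)) cs"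
      using cycle(1) by (rule closed_walk_mono) (use joined in \<open>simp add: \<kappa>_def\<close>)
    show "disjoint_family_on Y (set cs)"
      using clusters(2) Y cycle(4) unfolding disjoint_family_on_def by blast
    show "25 * \<kappa> i \<le> card (Y i) \<and> l \<le> \<kappa> i \<and> 2 * \<kappa> i \<le> 3 ^ h" if "i \<in> {hd cs, last cs}" for i
    proof -
      have "i \<in> set cs" using that cycle_len(1) by (cases cs) auto
      then show ?thesis using size bounds by simp
    qed
  qed (use cycle_len cycle(2) len(1,2) size in auto)
qed

lemma edge_free_subfamily:
  assumes sym: "symp R" and no_cycle: "\<not> contains_cycle R l"
    and len: "odd l" "2 * h + 3 + card I \<le> l" "l \<le> k" "2 * (25 ^ (2 * q - 1) * k) \<le> 3 ^ h"
    and index: "finite I" "card I = 2 * q + 1"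
    and clusters: "\<And>i. i \<in> I \<Longrightarrow> finite (V i) \<and> 25 ^ (2 * q - 1) * k \<le> card (V i)"
      "disjoint_family_on V I"
  obtains J Y where "J \<subseteq> I" "card J = q + 1" "\<And>i. i \<in> J \<Longrightarrow> Y i \<subseteq> V i \<and> card (Y i) = k"
    "pairwise (\<lambda>i j. edge_free R (Y i) (Y j)) J"
proof -
  have size0: "cluster_size q k 0 = 25 ^ (2 * q - 1) * k" by (simp add: cluster_size_def)
  obtain \<Phi> Y where sep: "separated R V (cluster_size q k) I \<Phi> Y"
    and joined: "\<And>i j. complement_edge I \<Phi> i j \<Longrightarrow>
       joined R (Y i) (cluster_size q k (Suc (card (\<Phi> `` {i}))))
         (Y j) (cluster_size q k (Suc (card (\<Phi> `` {j}))))"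
    by (rule maximal_separated[OF sym index(1), of "cluster_size q k" V])
       (use clusters(1) in \<open>auto simp: size0\<close>)
  have "sym \<Phi>" and free: "\<And>i j. (i, j) \<in> \<Phi> \<Longrightarrow> edge_free R (Y i) (Y j)"
    and Y: "\<And>i. i \<in> I \<Longrightarrow> Y i \<subseteq> V i \<and> k \<le> card (Y i)"
    using sep by (auto simp: separated_def cluster_size_lower)
  have "\<forall>i j. complement_edge I \<Phi> i j \<longrightarrow> i \<in> I \<and> j \<in> I" by (simp add: complement_edge_def)
  with symp_complement_edge[OF \<open>sym \<Phi>\<close>] show ?thesis
  proof (cases rule: odd_cycle_or_independent_half)
    case (odd_cycle cs)
    have "contains_cycle R l"
      by (rule separated_odd_cycle[OF sym index _ clusters(2) sep joined odd_cycle])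
         (use clusters(1) len in \<open>auto simp: size0\<close>)
    with no_cycle show ?thesis by simp
  next
    case (independent J')
    then have "q + 1 \<le> card J'" using index(2) by simp
    then obtain J where J: "J \<subseteq> J'" "card J = q + 1" by (rule obtain_subset_with_card_n)
    have JI: "J \<subseteq> I" using J(1) independent(1) by blast
    then have "\<exists>X. X \<subseteq> Y i \<and> card X = k" if "i \<in> J" for i
      using Y[of i] that by (meson obtain_subset_with_card_n subsetD)
    then obtain X where X: "\<And>i. i \<in> J \<Longrightarrow> X i \<subseteq> Y i \<and> card (X i) = k" by metis
    have "edge_free R (X i) (X j)" if "i \<in> J" "j \<in> J" "i \<noteq> j" for i j
    proof -
      have "(i, j) \<in> \<Phi>"
        using independent(3)[of i j] J(1) JI that by (auto simp: complement_edge_def)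
      from free[OF this] show ?thesis by (rule edge_free_mono) (use X that in blast)+
    qed
    moreover have "X i \<subseteq> V i \<and> card (X i) = k" if "i \<in> J" for i
      using X[OF that] Y[of i] that JI by blast
    ultimately show ?thesis using JI J(2) by (intro that[of J X]) (auto simp: pairwise_def)
  qed
qed

section \<open>Eliminating all colours\<close>

definition has_edge_free_pair ::
    "('c \<Rightarrow> 'a \<Rightarrow> 'a \<Rightarrow> bool) \<Rightarrow> 'c set \<Rightarrow> nat \<Rightarrow> 'a set \<Rightarrow> 'a set \<Rightarrow> bool" where
  "has_edge_free_pair F C k A B \<longleftrightarrow>
     (\<exists>X Y. X \<subseteq> A \<and> Y \<subseteq> B \<and> card X = k \<and> card Y = k \<and> (\<forall>c\<in>C. edge_free (F c) X Y))"

lemma has_edge_free_pair_empty: "k \<le> card A \<Longrightarrow> k \<le> card B \<Longrightarrow> has_edge_free_pair F {} k A B"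
  unfolding has_edge_free_pair_def by (metis empty_iff obtain_subset_with_card_n)

lemma has_edge_free_pair_insert:
  assumes "has_edge_free_pair F C k A' B'" "edge_free (F c) A' B'" "A' \<subseteq> A" "B' \<subseteq> B"
  shows "has_edge_free_pair F (insert c C) k A B"
proof -
  obtain X Y where XY: "X \<subseteq> A'" "Y \<subseteq> B'" "card X = k" "card Y = k"
      "\<forall>d\<in>C. edge_free (F d) X Y"
    using assms(1) by (auto simp: has_edge_free_pair_def)
  moreover have "edge_free (F c) X Y" using assms(2) XY(1,2) by (rule edge_free_mono)
  moreover have "X \<subseteq> A" "Y \<subseteq> B" using XY(1,2) assms(3,4) by auto
  ultimately show ?thesis
    unfolding has_edge_free_pair_def by (intro exI[of _ X] exI[of _ Y]) simp
qed

lemma edge_free_subpair_even_colours: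
  fixes F :: "'c \<Rightarrow> 'a \<Rightarrow> 'a \<Rightarrow> bool" and len :: "'c \<Rightarrow> nat"
  assumes "finite C"
    and "\<And>c. c \<in> C \<Longrightarrow> symp (F c) \<and> \<not> contains_cycle (F c) (len c) \<and> even (len c) \<and>
                     2 * h + 5 \<le> len c \<and> len c \<le> k"
    and "2 * (25 ^ card C * k) \<le> 3 ^ h" and "finite A" "finite B" "A \<inter> B = {}"
    and "25 ^ card C * k \<le> card A" "25 ^ card C * k \<le> card B"
  shows "has_edge_free_pair F C k A B"
  using assms
proof (induction C arbitrary: A B)
  case empty
  then show ?case by (simp add: has_edge_free_pair_empty)
next
  case (insert c C)
  let ?k = "25 ^ card C * k"
  have colour: "symp (F c)" "\<not> contains_cycle (F c) (len c)" "even (len c)" "2 * h + 5 \<le> len c"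
      "len c \<le> k"
    using insert.prems(1)[of c] by auto
  have card: "25 ^ card (insert c C) * k = 25 * ?k" using insert.hyps by simp
  have "len c \<le> ?k" using colour(5) by (rule order_trans) simp
  then obtain A' B' where sub: "A' \<subseteq> A" "B' \<subseteq> B" and cards: "card A' = ?k" "card B' = ?k"
      and free: "edge_free (F c) A' B'"
    by (rule edge_free_subpair[OF colour(1-4) _ _ insert.prems(3-5)])
       (use insert.prems(2,6,7) in \<open>simp_all add: card del: card_insert_disjoint\<close>)
  have "has_edge_free_pair F C k A' B'"
  proof (rule insert.IH)
    show "finite A'" "finite B'" using sub insert.prems(3,4) by (auto intro: finite_subset)
    show "A' \<inter> B' = {}" using sub insert.prems(5) by blast
    show "2 * ?k \<le> 3 ^ h" using insert.prems(2) unfolding card by simp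
    show "symp (F d) \<and> \<not> contains_cycle (F d) (len d) \<and> even (len d) \<and> 2 * h + 5 \<le> len d \<and>
        len d \<le> k" if "d \<in> C" for d
      using insert.prems(1)[of d] that by simp
  qed (use cards in simp_all)
  then show ?case using free sub by (rule has_edge_free_pair_insert)
qed

text \<open>The exponent of 25 lost when \<open>s\<close> odd colours reduce \<open>2 ^ s + 1\<close> clusters to 2 through
  \<open>2 ^ (s - 1) + 1\<close>, \<open>2 ^ (s - 2) + 1\<close>, \<open>\<dots>\<close> clusters.\<close>

fun odd_cost :: "nat \<Rightarrow> nat" where
  "odd_cost 0 = 0"
| "odd_cost (Suc s) = (2 * 2 ^ s - 1) + odd_cost s"

lemma edge_free_subfamily_odd_cost:
  assumes cycle_free: "symp R" "\<not> contains_cycle R l"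
    and len: "odd l" "2 * h + 3 + card I \<le> l" "l \<le> k"
    and scale: "2 * (25 ^ odd_cost (Suc s) * k) \<le> 3 ^ h"
    and index: "finite I" "card I = 2 ^ Suc s + 1"
    and clusters: "\<And>i. i \<in> I \<Longrightarrow> finite (V i) \<and> 25 ^ odd_cost (Suc s) * k \<le> card (V i)"
      "disjoint_family_on V I"
  obtains J Y where "J \<subseteq> I" "card J = 2 ^ s + 1"
    "\<And>i. i \<in> J \<Longrightarrow> Y i \<subseteq> V i \<and> card (Y i) = 25 ^ odd_cost s * k"
    "pairwise (\<lambda>i j. edge_free R (Y i) (Y j)) J"
proof -
  have cost: "25 ^ odd_cost (Suc s) * k = 25 ^ (2 * 2 ^ s - 1) * (25 ^ odd_cost s * k)"
    by (simp only: odd_cost.simps power_add mult.assoc)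
  have "l \<le> 25 ^ odd_cost s * k" using len(3) by (rule order_trans) simp
  then show thesis
  proof (rule edge_free_subfamily[OF cycle_free len(1,2)])
    show "2 * (25 ^ (2 * 2 ^ s - 1) * (25 ^ odd_cost s * k)) \<le> 3 ^ h" using scale unfolding cost .
    show "finite (V i) \<and> 25 ^ (2 * 2 ^ s - 1) * (25 ^ odd_cost s * k) \<le> card (V i)" if "i \<in> I" for i
      using clusters(1)[OF that] unfolding cost .
    show "card I = 2 * 2 ^ s + 1" using index(2) by simp
  qed (rule index(1) clusters(2) that; assumption)+
qed

lemma edge_free_subpair_odd_colours:
  fixes F :: "'c \<Rightarrow> 'a \<Rightarrow> 'a \<Rightarrow> bool" and len :: "'c \<Rightarrow> nat" and V :: "'i \<Rightarrow> 'a set"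
  assumes "finite C"
    and "\<And>c. c \<in> C \<Longrightarrow> symp (F c) \<and> \<not> contains_cycle (F c) (len c) \<and> odd (len c) \<and>
                     2 * h + 3 + card I \<le> len c \<and> len c \<le> k"
    and "2 * (25 ^ odd_cost (card C) * k) \<le> 3 ^ h"
    and "finite I" "card I = 2 ^ card C + 1" "disjoint_family_on V I"
    and "\<And>i. i \<in> I \<Longrightarrow> finite (V i) \<and> 25 ^ odd_cost (card C) * k \<le> card (V i)"
  shows "\<exists>i\<in>I. \<exists>j\<in>I. i \<noteq> j \<and> has_edge_free_pair F C k (V i) (V j)"
  using assms
proof (induction C arbitrary: I V)
  case empty
  then have "card I = 2" by simp
  then obtain i j where "i \<noteq> j" "I = {i, j}" by (auto simp: card_2_iff)
  then show ?case
    using empty.prems(6) by (intro bexI[of _ i] bexI[of _ j]) (auto intro: has_edge_free_pair_empty)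
next
  case (insert c C)
  let ?k = "25 ^ odd_cost (card C) * k"
  have card: "card (insert c C) = Suc (card C)" using insert.hyps by simp
  have colour: "symp (F c)" "\<not> contains_cycle (F c) (len c)" "odd (len c)"
      "2 * h + 3 + card I \<le> len c" "len c \<le> k"
    using insert.prems(1)[of c] by auto
  obtain J Y where index: "J \<subseteq> I" "card J = 2 ^ card C + 1"
      and clusters: "\<And>i. i \<in> J \<Longrightarrow> Y i \<subseteq> V i \<and> card (Y i) = ?k"
      and free: "pairwise (\<lambda>i j. edge_free (F c) (Y i) (Y j)) J"
  proof (rule edge_free_subfamily_odd_cost[OF colour insert.prems(2)[unfolded card]
        insert.prems(3) insert.prems(4)[unfolded card] _ insert.prems(5)])
    show "finite (V i) \<and> 25 ^ odd_cost (Suc (card C)) * k \<le> card (V i)" if "i \<in> I" for i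
      using insert.prems(6)[OF that] unfolding card .
  qed (rule that)
  have "finite J" "card J \<le> card I"
    using index(1) insert.prems(3) by (auto intro: finite_subset card_mono)
  then have "\<exists>i\<in>J. \<exists>j\<in>J. i \<noteq> j \<and> has_edge_free_pair F C k (Y i) (Y j)"
  proof (intro insert.IH)
    show "symp (F d) \<and> \<not> contains_cycle (F d) (len d) \<and> odd (len d) \<and>
        2 * h + 3 + card J \<le> len d \<and> len d \<le> k" if "d \<in> C" for d
      using insert.prems(1)[of d] that \<open>card J \<le> card I\<close> by simp
    have "odd_cost (card C) \<le> odd_cost (Suc (card C))" by (simp only: odd_cost.simps le_add2)
    then have "?k \<le> 25 ^ odd_cost (Suc (card C)) * k" by (intro mult_le_mono1 power_increasing) auto
    then show "2 * ?k \<le> 3 ^ h" using insert.prems(2) unfolding card by linarith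
    show "disjoint_family_on Y J"
      using insert.prems(5) clusters index(1) unfolding disjoint_family_on_def by blast
    show "finite (Y i) \<and> ?k \<le> card (Y i)" if "i \<in> J" for i
      using clusters[OF that] insert.prems(6)[of i] that index(1) by (auto intro: finite_subset)
  qed (use index in auto)
  then obtain i j where ij: "i \<in> J" "j \<in> J" "i \<noteq> j" and pair: "has_edge_free_pair F C k (Y i) (Y j)"
    by blast
  have "edge_free (F c) (Y i) (Y j)" using free ij by (auto simp: pairwise_def)
  with pair have "has_edge_free_pair F (insert c C) k (V i) (V j)"
    by (rule has_edge_free_pair_insert) (use clusters ij in auto)
  moreover have "i \<in> I" "j \<in> I" using ij(1,2) index(1) by auto
  ultimately show ?case using ij(3) by blast
qed

text \<open>The first odd colour splits every set in two, \<open>q\<close> times, at a factor 52 each; this already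
  yields the \<open>2 ^ (q - 1) + 1\<close> clusters needed for the other odd colours.\<close>

definition odd_factor :: "nat \<Rightarrow> nat" where
  "odd_factor q = (if q = 0 then 2 else 52 ^ q * 25 ^ odd_cost (q - 1))"

definition vertex_factor :: "nat \<Rightarrow> nat \<Rightarrow> nat" where
  "vertex_factor p q = odd_factor q * 25 ^ p"

lemma odd_factor_Suc: "odd_factor (Suc s) = 52 ^ Suc s * 25 ^ odd_cost s"
  by (simp add: odd_factor_def)

lemma edge_free_pair_insert_odd_colour:
  fixes F :: "'c \<Rightarrow> 'a \<Rightarrow> 'a \<Rightarrow> bool" and len :: "'c \<Rightarrow> nat"
  assumes fin: "finite C" "c \<notin> C"
    and colours: "\<And>d. d \<in> insert c C \<Longrightarrow> symp (F d) \<and> \<not> contains_cycle (F d) (len d) \<and> odd (len d) \<and>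
                     2 * h + 4 + 2 * 2 ^ card C \<le> len d \<and> len d \<le> k"
    and vertices: "finite V" "52 ^ Suc (card C) * (25 ^ odd_cost (card C) * k) \<le> card V"
      "2 * card V \<le> 3 ^ h"
  obtains S T where "S \<subseteq> V" "T \<subseteq> V" "S \<inter> T = {}" "has_edge_free_pair F (insert c C) k S T"
proof -
  let ?s = "card C" and ?L = "25 ^ odd_cost (card C) * k"
  have one: "(1::nat) \<le> 2 ^ ?s" by simp
  have colour: "symp (F c)" "\<not> contains_cycle (F c) (len c)" "2 * h + 4 + 2 * 2 ^ ?s \<le> len c"
      "len c \<le> k"
    using colours[of c] by auto
  have "k \<le> ?L" by simp
  then have len_c: "2 * h + 6 \<le> len c" "len c \<le> ?L" using colour(3,4) one by linarith+
  have scale: "2 * (52 ^ Suc ?s * ?L) \<le> 3 ^ h" using vertices(2,3) by (meson le_trans mult_le_mono2)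
  obtain \<Z> where card_\<Z>: "card \<Z> = 2 ^ Suc ?s" and family: "edge_free_family (F c) V ?L \<Z>"
    using edge_free_family_within[OF colour(1,2) len_c vertices(1,2) scale] by blast
  have \<Z>: "\<And>Z. Z \<in> \<Z> \<Longrightarrow> Z \<subseteq> V \<and> card Z = ?L"
    "\<And>X Y. X \<in> \<Z> \<Longrightarrow> Y \<in> \<Z> \<Longrightarrow> X \<noteq> Y \<Longrightarrow> X \<inter> Y = {} \<and> edge_free (F c) X Y"
    using family by (auto simp: edge_free_family_def pairwise_def)
  have "2 ^ ?s + 1 \<le> card \<Z>" using one unfolding card_\<Z> power_Suc by linarith
  then obtain I where index: "I \<subseteq> \<Z>" "card I = 2 ^ ?s + 1" by (rule obtain_subset_with_card_n)
  have "\<exists>S\<in>I. \<exists>T\<in>I. S \<noteq> T \<and> has_edge_free_pair F C k S T"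
  proof (rule edge_free_subpair_odd_colours[OF fin(1), where len = len and h = h])
    show "symp (F d) \<and> \<not> contains_cycle (F d) (len d) \<and> odd (len d) \<and> 2 * h + 3 + card I \<le> len d \<and>
        len d \<le> k" if "d \<in> C" for d
      using colours[of d] that by (auto simp: index(2))
    have "?L \<le> 52 ^ Suc ?s * ?L" by simp
    then show "2 * ?L \<le> 3 ^ h" using scale by linarith
    show "finite I" using index(2) by (simp add: card_ge_0_finite)
    show "disjoint_family_on (\<lambda>S. S) I"
      using \<Z>(2) index(1) unfolding disjoint_family_on_def by blast
    show "finite S \<and> ?L \<le> card S" if "S \<in> I" for S
      using \<Z>(1)[of S] that index(1) vertices(1) by (auto intro: finite_subset)
  qed (rule index(2))
  then obtain S T where ST: "S \<in> \<Z>" "T \<in> \<Z>" "S \<noteq> T" and pair: "has_edge_free_pair F C k S T"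
    using index(1) by blast
  have "has_edge_free_pair F (insert c C) k S T"
    using pair by (rule has_edge_free_pair_insert) (use \<Z>(2) ST in auto)
  then show ?thesis using \<Z> ST by (intro that[of S T]) auto
qed

lemma edge_free_pair_odd_colours:
  fixes F :: "'c \<Rightarrow> 'a \<Rightarrow> 'a \<Rightarrow> bool" and len :: "'c \<Rightarrow> nat"
  assumes fin: "finite C"
    and colours: "\<And>c. c \<in> C \<Longrightarrow> symp (F c) \<and> \<not> contains_cycle (F c) (len c) \<and> odd (len c) \<and>
                     2 * h + 4 + 2 ^ card C \<le> len c \<and> len c \<le> k"
    and vertices: "finite V" "odd_factor (card C) * k \<le> card V" "2 * card V \<le> 3 ^ h"
  obtains A B where "A \<subseteq> V" "B \<subseteq> V" "A \<inter> B = {}" "card A = k" "card B = k"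
    "\<And>c. c \<in> C \<Longrightarrow> edge_free (F c) A B"
proof (cases "C = {}")
  case True
  then have "k + k \<le> card V" using vertices(2) by (simp add: odd_factor_def)
  then obtain A B where "A \<subseteq> V" "B \<subseteq> V" "A \<inter> B = {}" "card A = k" "card B = k"
    by (rule obtain_disjoint_subsets[OF vertices(1)])
  with True show ?thesis by (intro that[of A B]) auto
next
  case False
  then obtain c D where C_eq: "C = insert c D" "c \<notin> D" "finite D"
    using fin by (metis Set.set_insert ex_in_conv finite_insert)
  then have card: "card C = Suc (card D)" by simp
  obtain S T where ST: "S \<subseteq> V" "T \<subseteq> V" "S \<inter> T = {}" and "has_edge_free_pair F (insert c D) k S T"
  proof (rule edge_free_pair_insert_odd_colour[OF C_eq(3,2) _ vertices(1) _ vertices(3)])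
    show "symp (F d) \<and> \<not> contains_cycle (F d) (len d) \<and> odd (len d) \<and>
        2 * h + 4 + 2 * 2 ^ card D \<le> len d \<and> len d \<le> k" if "d \<in> insert c D" for d
      using colours[of d] that C_eq(2,3) by (simp add: C_eq(1))
    show "52 ^ Suc (card D) * (25 ^ odd_cost (card D) * k) \<le> card V"
      using vertices(2) unfolding card odd_factor_Suc mult.assoc .
  qed (rule that)
  then obtain A B where "A \<subseteq> S" "B \<subseteq> T" "card A = k" "card B = k" "\<forall>d\<in>C. edge_free (F d) A B"
    by (auto simp: has_edge_free_pair_def C_eq(1))
  with ST show ?thesis by (intro that[of A B]) auto
qed

definition hole_free :: "('a \<Rightarrow> 'a \<Rightarrow> bool) \<Rightarrow> 'a set \<Rightarrow> nat \<Rightarrow> bool" where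
  "hole_free R V n \<longleftrightarrow> (\<forall>X Y. X \<subseteq> V \<longrightarrow> Y \<subseteq> V \<longrightarrow> X \<inter> Y = {} \<longrightarrow> card X = n \<longrightarrow> card Y = n \<longrightarrow>
     \<not> edge_free R X Y)"

lemma hole_free_mono: "hole_free R V n \<Longrightarrow> (\<And>x y. R x y \<Longrightarrow> R' x y) \<Longrightarrow> hole_free R' V n"
  unfolding hole_free_def edge_free_def by metis

lemma monochromatic_cycle:
  fixes F :: "'c \<Rightarrow> 'a \<Rightarrow> 'a \<Rightarrow> bool" and len :: "'c \<Rightarrow> nat"
  assumes finC: "finite C" and finV: "finite V"
    and size: "vertex_factor (card {c \<in> C. even (len c)}) (card {c \<in> C. odd (len c)}) * n \<le> card V"
    and scale: "2 * card V \<le> 3 ^ h"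
    and colours: "\<And>c. c \<in> C \<Longrightarrow> symp (F c) \<and> 2 * h + 4 + 2 ^ card C \<le> len c \<and> len c \<le> n"
    and hole_free: "hole_free (\<lambda>x y. \<exists>c\<in>C. F c x y) V n"
  shows "\<exists>c\<in>C. contains_cycle (F c) (len c)"
proof (rule ccontr)
  assume "\<not> ?thesis"
  then have no_cycle: "\<not> contains_cycle (F c) (len c)" if "c \<in> C" for c using that by blast
  define E where "E = {c \<in> C. even (len c)}"
  define D where "D = {c \<in> C. odd (len c)}"
  have fin: "finite E" "finite D" using finC by (auto simp: E_def D_def)
  let ?k = "25 ^ card E * n"
  have powers: "(2::nat) ^ card D \<le> 2 ^ card C" "(1::nat) \<le> 2 ^ card C"
    using finC by (auto simp: D_def intro!: power_increasing card_mono)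
  have "n \<le> ?k" by simp
  then have cycle_free: "symp (F c) \<and> \<not> contains_cycle (F c) (len c) \<and>
      2 * h + 4 + 2 ^ card D \<le> len c \<and> 2 * h + 5 \<le> len c \<and> len c \<le> n \<and> len c \<le> ?k" if "c \<in> C" for c
    using colours[OF that] no_cycle[OF that] powers by linarith
  obtain A B where AB: "A \<subseteq> V" "B \<subseteq> V" "A \<inter> B = {}" "card A = ?k" "card B = ?k"
      and odd_free: "\<And>c. c \<in> D \<Longrightarrow> edge_free (F c) A B"
  proof (rule edge_free_pair_odd_colours[OF fin(2) _ finV _ scale])
    show "symp (F c) \<and> \<not> contains_cycle (F c) (len c) \<and> odd (len c) \<and>
        2 * h + 4 + 2 ^ card D \<le> len c \<and> len c \<le> ?k" if "c \<in> D" for c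
      using that cycle_free[of c] by (auto simp: D_def)
    show "odd_factor (card D) * ?k \<le> card V"
      using size by (simp add: vertex_factor_def E_def D_def mult.assoc)
  qed (rule that)
  have "has_edge_free_pair F E n A B"
  proof (rule edge_free_subpair_even_colours[OF fin(1), where len = len and h = h])
    show "symp (F c) \<and> \<not> contains_cycle (F c) (len c) \<and> even (len c) \<and>
        2 * h + 5 \<le> len c \<and> len c \<le> n" if "c \<in> E" for c
      using that cycle_free[of c] by (auto simp: E_def)
    have "?k \<le> card V" using AB(1,4) finV by (metis card_mono)
    then show "2 * ?k \<le> 3 ^ h" using scale by linarith
    show "finite A" "finite B" using AB(1,2) finV by (auto intro: finite_subset)
  qed (use AB in auto)
  then obtain X Y where XY: "X \<subseteq> A" "Y \<subseteq> B" "card X = n" "card Y = n"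
      and even_free: "\<forall>c\<in>E. edge_free (F c) X Y" by (auto simp: has_edge_free_pair_def)
  have "X \<subseteq> V" "Y \<subseteq> V" "X \<inter> Y = {}" using XY(1,2) AB(1-3) by blast+
  then have "\<not> edge_free (\<lambda>x y. \<exists>c\<in>C. F c x y) X Y"
    using hole_free XY(3,4) by (simp add: hole_free_def)
  then obtain c where "c \<in> C" "\<not> edge_free (F c) X Y" by (auto simp: edge_free_def)
  moreover have "edge_free (F c) X Y" if "c \<in> D"
    using odd_free[OF that] XY(1,2) by (rule edge_free_mono)
  ultimately show False using even_free by (auto simp: D_def E_def)
qed

section \<open>A sparse graph without bipartite holes\<close>

lemma ex_element_in_many_sets:
  fixes H :: "'p \<Rightarrow> 'e set"
  assumes finP: "finite P" and finK: "finite K" and nonempty: "K \<noteq> {}"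
    and large_sets: "\<And>p. p \<in> P \<Longrightarrow> H p \<subseteq> K \<and> s \<le> card (H p)"
  shows "\<exists>e\<in>K. s * card P \<le> card K * card {p \<in> P. e \<in> H p}"
proof (rule ccontr)
  assume "\<not> ?thesis"
  then have rare: "card K * card {p \<in> P. e \<in> H p} < s * card P" if "e \<in> K" for e
    using that by (simp add: not_le)
  have "s * card P \<le> (\<Sum>p\<in>P. card (H p))"
    using large_sets sum_mono[of P "\<lambda>_. s" "\<lambda>p. card (H p)"] by (simp add: mult.commute)
  also have "\<dots> = (\<Sum>e\<in>K. card {p \<in> P. e \<in> H p})"
  proof (rule sum_multicount_gen[symmetric, OF finK finP], rule ballI)
    fix p assume "p \<in> P"
    then have "{e \<in> K. e \<in> H p} = H p" using large_sets by blast
    then show "card {e \<in> K. e \<in> H p} = card (H p)" by simp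
  qed
  finally have "card K * (s * card P) \<le> (\<Sum>e\<in>K. card K * card {p \<in> P. e \<in> H p})"
    by (simp flip: sum_distrib_left)
  also have "\<dots> < (\<Sum>e\<in>K. s * card P)" by (rule sum_strict_mono[OF finK nonempty rare])
  finally show False by simp
qed

lemma greedy_hitting_set:
  fixes H :: "'p \<Rightarrow> 'e set"
  assumes finP: "finite P" and finK: "finite K" and ground: "K \<noteq> {}" "s \<le> card K"
    and large_sets: "\<And>p. p \<in> P \<Longrightarrow> H p \<subseteq> K \<and> s \<le> card (H p)"
  shows "\<exists>E\<subseteq>K. card E \<le> m \<and> real (card {p \<in> P. E \<inter> H p = {}}) \<le> card P * (1 - s / card K) ^ m"
proof (induction m)
  case 0
  show ?case by (intro exI[of _ "{}"]) simp
next
  case (Suc m)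
  then obtain E where E: "E \<subseteq> K" "card E \<le> m"
    and unhit: "real (card {p \<in> P. E \<inter> H p = {}}) \<le> card P * (1 - s / card K) ^ m" by blast
  define Q where "Q = {p \<in> P. E \<inter> H p = {}}"
  have finQ: "finite Q" using finP by (simp add: Q_def)
  obtain e where frequent: "e \<in> K" "s * card Q \<le> card K * card {p \<in> Q. e \<in> H p}"
    using ex_element_in_many_sets[OF finQ finK ground(1), of H s] large_sets by (auto simp: Q_def)
  have "{p \<in> P. insert e E \<inter> H p = {}} = Q - {p \<in> Q. e \<in> H p}" by (auto simp: Q_def)
  moreover have "card {p \<in> Q. e \<in> H p} \<le> card Q" using finQ by (auto intro: card_mono)
  ultimately have "real (card {p \<in> P. insert e E \<inter> H p = {}})
      = real (card Q) - real (card {p \<in> Q. e \<in> H p})"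
    using finQ by (simp add: card_Diff_subset)
  also have "\<dots> \<le> (1 - s / card K) * card Q"
  proof -
    have "real s * real (card Q) \<le> real (card K) * real (card {p \<in> Q. e \<in> H p})"
      using frequent(2) by (simp flip: of_nat_mult)
    then show ?thesis using finK ground(1) by (simp add: field_simps card_gt_0_iff)
  qed
  also have "\<dots> \<le> (1 - s / card K) * (card P * (1 - s / card K) ^ m)"
    using unhit ground finK by (intro mult_left_mono) (auto simp: Q_def card_gt_0_iff)
  finally have "real (card {p \<in> P. insert e E \<inter> H p = {}}) \<le> card P * (1 - s / card K) ^ Suc m"
    by (simp add: algebra_simps)
  moreover have "card (insert e E) \<le> Suc m"
    using E finK card_insert_le_m1[of "Suc m" E e] by simp
  ultimately show ?case using E(1) frequent(1) by (intro exI[of _ "insert e E"]) auto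
qed

lemma small_hitting_set:
  fixes H :: "'p \<Rightarrow> 'e set"
  assumes finP: "finite P" and finK: "finite K" and nonempty: "K \<noteq> {}"
    and large_sets: "\<And>p. p \<in> P \<Longrightarrow> H p \<subseteq> K \<and> s \<le> card (H p)"
    and few: "real (card P) < exp (s * m / card K)"
  obtains E where "E \<subseteq> K" "card E \<le> m" "\<And>p. p \<in> P \<Longrightarrow> E \<inter> H p \<noteq> {}"
proof (cases "P = {}")
  case True
  then show ?thesis by (intro that[of "{}"]) auto
next
  case False
  then obtain p where "p \<in> P" by blast
  then have s_le: "s \<le> card K" using large_sets[of p] card_mono[OF finK, of "H p"] by linarith
  define x where "x = s / card K"
  have ratio: "0 \<le> x" "x \<le> 1" using s_le by (auto simp: x_def divide_le_eq_1)
  have "\<exists>E\<subseteq>K. card E \<le> m \<and> real (card {p \<in> P. E \<inter> H p = {}}) \<le> card P * (1 - x) ^ m"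
    unfolding x_def by (rule greedy_hitting_set[OF finP finK nonempty s_le large_sets])
  then obtain E where E: "E \<subseteq> K" "card E \<le> m"
    and unhit: "real (card {p \<in> P. E \<inter> H p = {}}) \<le> card P * (1 - x) ^ m"
    by blast
  have "(1 - x) ^ m \<le> exp (- x) ^ m"
    using ratio exp_ge_add_one_self[of "- x"] by (intro power_mono) auto
  also have "\<dots> = exp (- (x * m))" by (simp add: exp_of_nat_mult[symmetric] mult.commute)
  finally have "card P * (1 - x) ^ m \<le> card P * exp (- (x * m))" by (rule mult_left_mono) simp
  also have "\<dots> < exp (x * m) * exp (- (x * m))"
    using few by (intro mult_strict_right_mono) (simp_all add: x_def)
  also have "\<dots> = 1" by (simp add: exp_minus_inverse)
  finally have "card {p \<in> P. E \<inter> H p = {}} = 0" using unhit by linarith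
  then have "{p \<in> P. E \<inter> H p = {}} = {}" using finP by simp
  with E show ?thesis by (intro that[of E]) auto
qed

lemma power_div_fact_le_exp:
  fixes x :: real assumes "0 \<le> x"
  shows "x ^ n / fact n \<le> exp x"
proof -
  have "(\<Sum>k\<in>{n}. x ^ k /\<^sub>R fact k) \<le> (\<Sum>k. x ^ k /\<^sub>R fact k)"
    using assms by (intro sum_le_suminf summable_exp_generic) auto
  then show ?thesis by (simp add: exp_def divide_inverse mult.commute)
qed

lemma binomial_mult_le_exp:
  assumes "0 < a"
  shows "real (a * n choose n) \<le> exp (n * (ln a + 1))"
proof -
  have "real (a * n choose n) * fact n \<le> real (a * n) ^ n"
    using binomial_fact_pow[of "a * n" n]
    by (metis of_nat_fact of_nat_le_iff of_nat_mult of_nat_power)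
  then have "real (a * n choose n) \<le> real a ^ n * (real n ^ n / fact n)"
    by (simp add: field_simps power_mult_distrib)
  also have "\<dots> \<le> real a ^ n * exp n" by (intro mult_left_mono power_div_fact_le_exp) auto
  also have "real a ^ n = exp (n * ln a)" using assms by (simp add: exp_of_nat_mult)
  finally show ?thesis by (simp add: exp_add[symmetric] algebra_simps)
qed

definition edges_between :: "'a set \<Rightarrow> 'a set \<Rightarrow> 'a set set" where
  "edges_between X Y = (\<lambda>(x, y). {x, y}) ` (X \<times> Y)"

lemma card_edges_between:
  assumes "X \<inter> Y = {}"
  shows "card (edges_between X Y) = card X * card Y"
proof -
  have "inj_on (\<lambda>(x, y). {x, y}) (X \<times> Y)" using assms by (auto simp: inj_on_def doubleton_eq_iff)
  then show ?thesis by (simp add: edges_between_def card_image card_cartesian_product)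
qed

lemma edges_between_subset:
  "X \<inter> Y = {} \<Longrightarrow> X \<subseteq> V \<Longrightarrow> Y \<subseteq> V \<Longrightarrow> edges_between X Y \<subseteq> {e. e \<subseteq> V \<and> card e = 2}"
  by (auto simp: edges_between_def card_insert_if)

lemma edge_free_iff_edges_between:
  "edge_free (\<lambda>x y. {x, y} \<in> E) X Y \<longleftrightarrow> E \<inter> edges_between X Y = {}"
  by (auto simp: edge_free_def edges_between_def)

lemma card_doubletons_less:
  assumes "0 < M"
  shows "2 * card {e. e \<subseteq> {..<M} \<and> card e = 2} < M ^ 2"
proof -
  have "2 * card {e. e \<subseteq> {..<M} \<and> card e = 2} \<le> M * (M - 1)"
    by (simp add: n_subsets choose_two)
  also have "\<dots> < M ^ 2" using assms by (simp add: power2_eq_square)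
  finally show ?thesis .
qed

lemma binomial_square_less_exp:
  fixes a n k m :: nat
  assumes "0 < a" "0 < n" and ground_size: "0 < k" "2 * k < (a * n) ^ 2"
    and rounds: "(ln a + 1) * real a ^ 2 * n \<le> m"
  shows "real (a * n choose n) ^ 2 < exp (real (n ^ 2) * m / k)"
proof -
  have "real (a * n choose n) ^ 2 \<le> exp (n * (ln a + 1)) ^ 2"
    using assms(1) by (intro power_mono binomial_mult_le_exp) auto
  also have "\<dots> = exp (2 * n * (ln a + 1))" by (simp add: exp_of_nat_mult[symmetric] mult.assoc)
  also have "2 * n * (ln a + 1) < real (n ^ 2) * m / k"
  proof -
    have "2 * real k < real a ^ 2 * real n ^ 2"
      using ground_size(2)
      by (metis of_nat_less_iff of_nat_mult of_nat_numeral of_nat_power power_mult_distrib)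
    moreover have "0 < n * (ln a + 1)" using assms(1,2) by (simp add: add_nonneg_pos)
    ultimately have "2 * real k * (n * (ln a + 1)) < real a ^ 2 * real n ^ 2 * (n * (ln a + 1))"
      by (rule mult_strict_right_mono)
    also have "\<dots> = real n ^ 2 * ((ln a + 1) * real a ^ 2 * n)" by simp
    also have "\<dots> \<le> real n ^ 2 * m" using rounds by (rule mult_left_mono) simp
    finally show ?thesis using ground_size(1) by (simp add: field_simps)
  qed
  finally show ?thesis by simp
qed

lemma sparse_hole_free_graph:
  fixes a n :: nat
  assumes a_ge: "2 \<le> a" and n_ge: "1 \<le> n"
  obtains E where "is_graph E" "real (card E) \<le> (ln a + 1) * real a ^ 2 * n + 1"
    "hole_free (\<lambda>x y. {x, y} \<in> E) {..<a * n} n"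
proof -
  let ?S = "{X. X \<subseteq> {..<a * n} \<and> card X = n}"
  define K where "K = {e. e \<subseteq> {..<a * n} \<and> card e = 2}"
  define P where "P = {(X, Y). X \<in> ?S \<and> Y \<in> ?S \<and> X \<inter> Y = {}}"
  define m where "m = nat \<lceil>(ln a + 1) * real a ^ 2 * n\<rceil>"
  have "0 \<le> (ln a + 1) * real a ^ 2 * n" using a_ge by simp
  then have m_bounds: "(ln a + 1) * real a ^ 2 * n \<le> m" "m \<le> (ln a + 1) * real a ^ 2 * n + 1"
    unfolding m_def by linarith+
  have finK: "finite K" by (simp add: K_def)
  have "2 \<le> a * n" using mult_le_mono[OF a_ge n_ge] by simp
  with a_ge n_ge have "{0, 1} \<in> K" by (simp add: K_def)
  then have K_nonempty: "K \<noteq> {}" "0 < card K" using finK by (auto simp: card_gt_0_iff)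
  have P_subset: "P \<subseteq> ?S \<times> ?S" by (auto simp: P_def)
  then have finP: "finite P" by (rule finite_subset) simp
  have large_sets: "case_prod edges_between p \<subseteq> K \<and> n ^ 2 \<le> card (case_prod edges_between p)"
    if "p \<in> P" for p
  proof -
    obtain X Y where p: "p = (X, Y)" and disjoint: "X \<inter> Y = {}"
        and sub: "X \<subseteq> {..<a * n}" "Y \<subseteq> {..<a * n}" and cards: "card X = n" "card Y = n"
      using \<open>p \<in> P\<close> by (auto simp: P_def)
    show ?thesis
      using edges_between_subset[OF disjoint sub] card_edges_between[OF disjoint]
      by (simp add: p K_def cards power2_eq_square)
  qed
  have "card P \<le> card (?S \<times> ?S)" using P_subset by (rule card_mono[rotated]) simp
  then have "real (card P) \<le> real (a * n choose n) ^ 2"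
    by (simp add: n_subsets card_cartesian_product power2_eq_square flip: of_nat_mult)
  also have "\<dots> < exp (real (n ^ 2) * m / card K)"
    using a_ge n_ge K_nonempty(2) card_doubletons_less[of "a * n"] m_bounds(1)
    by (intro binomial_square_less_exp) (simp_all add: K_def)
  finally have few: "real (card P) < exp (real (n ^ 2) * m / card K)" .
  obtain E where E: "E \<subseteq> K" "card E \<le> m"
    and hit: "\<And>p. p \<in> P \<Longrightarrow> E \<inter> case_prod edges_between p \<noteq> {}"
  proof (rule small_hitting_set[OF finP finK K_nonempty(1) _ few])
    show "case_prod edges_between p \<subseteq> K \<and> n ^ 2 \<le> card (case_prod edges_between p)" if "p \<in> P" for p
      using that by (rule large_sets)
  qed (rule that)
  show ?thesis
  proof (rule that[of E])
    show "is_graph E" using E(1) finK by (auto simp: is_graph_def K_def intro: finite_subset)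
    show "real (card E) \<le> (ln a + 1) * real a ^ 2 * n + 1" using E(2) m_bounds(2) by linarith
    show "hole_free (\<lambda>x y. {x, y} \<in> E) {..<a * n} n"
      unfolding hole_free_def edge_free_iff_edges_between using hit by (auto simp: P_def)
  qed
qed

section \<open>The size-Ramsey number of cycles\<close>

lemma has_cycle_if_contains_cycle:
  assumes "contains_cycle (\<lambda>x y. {x, y} \<in> F) l" "3 \<le> l"
  shows "has_cycle l F"
proof -
  obtain xs where xs: "length xs = l" "distinct xs" "closed_walk (\<lambda>x y. {x, y} \<in> F) xs"
    using assms(1) by (auto simp: contains_cycle_def)
  have "{xs ! i, xs ! (Suc i mod l)} \<in> F" if "i < l" for i
  proof (cases "Suc i < l")
    case True
    then show ?thesis using xs by (auto simp: closed_walk_def successively_conv_nth)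
  next
    case False
    then have last_index: "i = l - 1" "Suc i mod l = 0"
      using that by (auto simp: le_Suc_eq not_less)
    have "{last xs, hd xs} \<in> F" "xs \<noteq> []" using xs(3) by (auto simp: closed_walk_def)
    then show ?thesis using last_index xs(1) by (simp add: last_conv_nth hd_conv_nth)
  qed
  moreover have "inj_on (\<lambda>i. xs ! i) {0..<l}"
    using xs by (auto simp: inj_on_def nth_eq_iff_index_eq)
  ultimately show ?thesis using assms(2) unfolding has_cycle_def by blast
qed

definition cycles_vertex_factor :: "nat list \<Rightarrow> nat" where
  "cycles_vertex_factor ns =
     vertex_factor (card {i. i < length ns \<and> even (ns ! i)})
       (card {i. i < length ns \<and> odd (ns ! i)})"

lemma arrows_cycles_if_hole_free:
  assumes vertices: "finite V" "2 * card V \<le> 3 ^ h" "cycles_vertex_factor ns * n \<le> card V"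
    and len: "\<And>i. i < length ns \<Longrightarrow> 2 * h + 4 + 2 ^ length ns \<le> ns ! i \<and> ns ! i \<le> n"
    and hole_free: "hole_free (\<lambda>x y. {x, y} \<in> E) V n"
  shows "arrows_cycles E ns"
  unfolding arrows_cycles_def
proof (intro allI impI)
  fix col :: "nat set \<Rightarrow> nat" assume col: "\<forall>e\<in>E. col e < length ns"
  let ?F = "\<lambda>i x y. {x, y} \<in> {e \<in> E. col e = i}"
  have "\<exists>i\<in>{..<length ns}. contains_cycle (?F i) (ns ! i)"
  proof (rule monochromatic_cycle[OF _ vertices(1) _ vertices(2)])
    show "symp (?F i) \<and> 2 * h + 4 + 2 ^ card {..<length ns} \<le> ns ! i \<and> ns ! i \<le> n"
      if "i \<in> {..<length ns}" for i
      using len[of i] that by (auto simp: symp_def insert_commute)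
    show "hole_free (\<lambda>x y. \<exists>i\<in>{..<length ns}. ?F i x y) V n"
      using hole_free by (rule hole_free_mono) (use col in auto)
  qed (use vertices(3) in \<open>simp_all add: cycles_vertex_factor_def\<close>)
  then obtain i where colour: "i < length ns" "contains_cycle (?F i) (ns ! i)" by auto
  then have "has_cycle (ns ! i) {e \<in> E. col e = i}"
    using len[of i] by (intro has_cycle_if_contains_cycle) auto
  then show "\<exists>i<length ns. has_cycle (ns ! i) {e \<in> E. col e = i}" using colour(1) by blast
qed

lemma size_ramsey_cycles_le_card:
  assumes "is_graph E" "arrows_cycles E ns"
  shows "size_ramsey_cycles ns \<le> card E"
  unfolding size_ramsey_cycles_def using assms by (intro Least_le) blast

lemma obtain_power_of_3_bound:
  fixes m y :: nat
  assumes "m \<le> 2 ^ y"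
  obtains h where "2 * m \<le> 3 ^ h" "3 * h \<le> 2 * (y + 3)"
proof -
  define j where "j = (y + 3) div 3"
  have j_bounds: "Suc y \<le> 3 * j" "3 * j \<le> y + 3" by (simp_all add: j_def)
  have "2 * m \<le> 2 ^ Suc y" using assms by simp
  also have "\<dots> \<le> (2::nat) ^ (3 * j)" using j_bounds(1) by (rule power_increasing) simp
  also have "\<dots> = 8 ^ j" by (simp add: power_mult)
  also have "\<dots> \<le> 9 ^ j" by (rule power_mono) auto
  also have "\<dots> = 3 ^ (2 * j)" by (simp add: power_mult)
  finally show ?thesis using j_bounds(2) by (intro that[of "2 * j"]) auto
qed

lemma two_le_vertex_factor: "2 \<le> vertex_factor p q"
proof -
  have "2 * 1 \<le> odd_factor q * 25 ^ p"
  proof (rule mult_le_mono)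
    show "2 \<le> odd_factor q"
    proof (cases q)
      case (Suc s)
      have "(52::nat) * 1 \<le> 52 ^ Suc s * 25 ^ odd_cost s" by (rule mult_le_mono) auto
      then show ?thesis by (simp add: odd_factor_def Suc)
    qed (simp add: odd_factor_def)
  qed simp
  then show ?thesis by (simp add: vertex_factor_def)
qed

lemma size_ramsey_cycles_le_vertex_factor:
  fixes ns :: "nat list"
  defines "n \<equiv> Max (set ns)" and "a \<equiv> cycles_vertex_factor ns"
  assumes n_pos: "1 \<le> n" and log_bound: "a * n \<le> 2 ^ y" "2 * 2 ^ length ns + 9 \<le> y"
    and long: "\<And>i. i < length ns \<Longrightarrow> 2 * y + 2 \<le> ns ! i"
  shows "size_ramsey_cycles ns \<le> (ln a + 1) * real a ^ 2 * n + 1"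
proof -
  have a_ge: "2 \<le> a" by (simp add: a_def cycles_vertex_factor_def two_le_vertex_factor)
  obtain h where scale: "2 * (a * n) \<le> 3 ^ h" "3 * h \<le> 2 * (y + 3)"
    using log_bound(1) by (rule obtain_power_of_3_bound)
  obtain E where graph: "is_graph E" "real (card E) \<le> (ln a + 1) * real a ^ 2 * n + 1"
    and hole_free: "hole_free (\<lambda>x y. {x, y} \<in> E) {..<a * n} n"
    using a_ge n_pos by (rule sparse_hole_free_graph)
  have "arrows_cycles E ns"
  proof (rule arrows_cycles_if_hole_free[OF _ _ _ _ hole_free])
    show "2 * h + 4 + 2 ^ length ns \<le> ns ! i \<and> ns ! i \<le> n" if "i < length ns" for i
    proof
      show "2 * h + 4 + 2 ^ length ns \<le> ns ! i" using long[OF that] scale(2) log_bound(2) by simp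
      show "ns ! i \<le> n" unfolding n_def using that by (intro Max_ge) auto
    qed
  qed (use scale(1) in \<open>simp_all add: a_def\<close>)
  then have "size_ramsey_cycles ns \<le> card E" by (rule size_ramsey_cycles_le_card[OF graph(1)])
  with graph(2) show ?thesis by linarith
qed

lemma edge_bound_mono:
  fixes a c n :: real
  assumes "1 \<le> a" "a + 1 \<le> c" "1 \<le> n"
  shows "(ln a + 1) * a ^ 2 * n + 1 \<le> (ln c + 1) * c ^ 2 * n"
proof -
  have "1 * 1 \<le> (ln a + 1) * n" using assms by (intro mult_mono) auto
  then have "(ln a + 1) * a ^ 2 * n + 1 \<le> (ln a + 1) * (a ^ 2 + 1) * n"
    by (simp add: algebra_simps)
  also have "\<dots> \<le> (ln c + 1) * c ^ 2 * n"
  proof -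
    have "ln a \<le> ln c" "0 \<le> ln a" using assms by auto
    moreover have "a ^ 2 + 1 \<le> c ^ 2"
    proof -
      have "a ^ 2 + 1 \<le> (a + 1) ^ 2" using assms by (simp add: power2_eq_square algebra_simps)
      also have "\<dots> \<le> c ^ 2" using assms by (intro power_mono) auto
      finally show ?thesis .
    qed
    ultimately show ?thesis using assms by (intro mult_right_mono mult_mono) auto
  qed
  finally show ?thesis .
qed

text \<open>The bound \<open>2 * 2 ^ t + 9\<close> on the logarithm makes up for the difference between the path orders
  \<open>2 * h + 4 + 2 ^ t\<close> with \<open>h\<close> about \<open>2 / 3 * log 2 (n * c)\<close> and the assumed cycle lengths.\<close>

lemma size_ramsey_cycles_upper_bound:
  fixes ns :: "nat list" and c :: real
  defines "n \<equiv> Max (set ns)" and "a \<equiv> cycles_vertex_factor ns"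
  assumes nonempty: "ns \<noteq> []" and factor_le: "real a + 1 \<le> c"
    and large: "\<And>i. i < length ns \<Longrightarrow> 2 ^ (2 * 2 ^ length ns + 9) \<le> ns ! i"
    and long: "\<And>i. i < length ns \<Longrightarrow> 2 * real_of_int \<lceil>log 2 (n * c)\<rceil> + 2 \<le> ns ! i"
  shows "size_ramsey_cycles ns \<le> (ln c + 1) * c ^ 2 * n"
proof -
  let ?k = "2 * 2 ^ length ns + 9 :: nat"
  define y where "y = nat \<lceil>log 2 (n * c)\<rceil>"
  have a_ge: "2 \<le> a" by (simp add: a_def cycles_vertex_factor_def two_le_vertex_factor)
  have "ns ! 0 \<le> n" unfolding n_def using nonempty by (intro Max_ge) auto
  then have large_n: "2 ^ ?k \<le> n" using large[of 0] nonempty by simp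
  then have n_pos: "1 \<le> n" by (meson le_trans one_le_numeral one_le_power)
  then have n_le: "real n \<le> n * c" "0 < n * c" using factor_le by auto
  have "2 ^ ?k = real (2 ^ ?k)" by simp
  also have "\<dots> \<le> real n" using large_n by (simp only: of_nat_le_iff)
  also note n_le(1)
  finally have "real ?k \<le> log 2 (n * c)" by (intro le_log_of_power) simp_all
  then have log_bound: "?k \<le> y" "real_of_int \<lceil>log 2 (n * c)\<rceil> = y" "log 2 (n * c) \<le> y"
    unfolding y_def by linarith+
  have "real (a * n) \<le> n * c" using factor_le mult_right_mono[of a c n] by (simp add: mult.commute)
  also have "\<dots> \<le> 2 ^ y" using log_bound(3) n_le(2) by (simp add: log_le_iff powr_realpow)
  finally have vertices_le: "a * n \<le> 2 ^ y" by (simp flip: of_nat_le_iff[where 'a = real])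
  have "size_ramsey_cycles ns \<le> (ln a + 1) * real a ^ 2 * n + 1"
    unfolding a_def n_def
  proof (rule size_ramsey_cycles_le_vertex_factor)
    show "2 * y + 2 \<le> ns ! i" if "i < length ns" for i
      using long[OF that] unfolding log_bound(2) by linarith
  qed (use n_pos vertices_le log_bound(1) in \<open>simp_all add: n_def a_def\<close>)
  also have "\<dots> \<le> (ln c + 1) * c ^ 2 * n"
    using factor_le n_pos a_ge by (intro edge_bound_mono) auto
  finally show ?thesis .
qed

lemma odd_factor_Suc_le: "odd_factor (Suc s) + 1 \<le> 82 * 35 ^ (2 ^ Suc s - 2)"
proof (induction s)
  case (Suc s)
  show ?case
  proof (cases s)
    case (Suc r)
    let ?m = "2 ^ Suc s :: nat"
    have m_ge: "4 \<le> ?m" by (simp add: Suc)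
    have pow: "52 * 25 ^ (?m - 1) \<le> (35::nat) ^ ?m"
      using m_ge
    proof (induction rule: dec_induct)
      case (step m)
      obtain j where "m = Suc j" using step.hyps by (cases m) auto
      then show ?case using step.IH by simp
    qed simp
    have "odd_factor (Suc (Suc s)) + 1 = odd_factor (Suc s) * (52 * 25 ^ (?m - 1)) + 1"
      by (simp only: odd_factor_Suc odd_cost.simps power_add power_Suc mult_ac)
    also have "\<dots> \<le> (odd_factor (Suc s) + 1) * (52 * 25 ^ (?m - 1))"
      by (simp add: algebra_simps)
    also have "\<dots> \<le> (82 * 35 ^ (?m - 2)) * 35 ^ ?m" by (rule mult_le_mono[OF Suc.IH pow])
    also have "\<dots> = 82 * 35 ^ (?m - 2 + ?m)" by (simp only: power_add mult.assoc)
    also have "?m - 2 + ?m = 2 ^ Suc (Suc s) - 2" using m_ge by simp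
    finally show ?thesis .
  qed (simp add: odd_factor_def)
qed (simp add: odd_factor_def)

lemma vertex_factor_le:
  assumes "1 \<le> p + q"
  shows "real (vertex_factor p q) + 1 \<le> 82 * 35 powr (2 ^ q - 2) * 81 ^ p"
proof (cases q)
  case 0
  have "(25::real) ^ p \<le> 81 ^ p" by (rule power_mono) auto
  moreover have "(81::real) ^ 1 \<le> 81 ^ p" using assms 0 by (intro power_increasing) auto
  ultimately show ?thesis using 0 by (simp add: vertex_factor_def odd_factor_def powr_minus)
next
  case (Suc s)
  have "vertex_factor p q + 1 \<le> (odd_factor q + 1) * 25 ^ p"
    by (simp add: vertex_factor_def)
  also have "\<dots> \<le> (82 * 35 ^ (2 ^ q - 2)) * 81 ^ p"
    unfolding Suc by (rule mult_le_mono[OF odd_factor_Suc_le]) (rule power_mono, auto)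
  finally have "real (vertex_factor p q + 1) \<le> real ((82 * 35 ^ (2 ^ q - 2)) * 81 ^ p)"
    by (simp only: of_nat_le_iff)
  moreover have "real (2 ^ q - 2) = 2 ^ q - 2"
    using Suc by (subst of_nat_diff) (auto simp: self_le_power)
  then have "(35::real) powr (2 ^ q - 2) = 35 ^ (2 ^ q - 2)"
    by (metis powr_realpow zero_less_numeral)
  ultimately show ?thesis by simp
qed

lemma cycles_vertex_factor_le:
  assumes "ns \<noteq> []"
  shows "real (cycles_vertex_factor ns) + 1
    \<le> 82 * 35 powr (2 ^ card {i. i < length ns \<and> odd (ns ! i)} - 2)
      * 81 ^ card {i. i < length ns \<and> even (ns ! i)}"
  unfolding cycles_vertex_factor_def
proof (rule vertex_factor_le)
  let ?even = "{i. i < length ns \<and> even (ns ! i)}" and ?odd = "{i. i < length ns \<and> odd (ns ! i)}"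
  have "card ?even + card ?odd = card (?even \<union> ?odd)"
    by (rule card_Un_disjoint[symmetric]) auto
  also have "?even \<union> ?odd = {..<length ns}" by auto
  finally show "1 \<le> card ?even + card ?odd" using assms by (simp add: Suc_le_eq)
qed

theorem theorem1p1:
  fixes t :: nat
  assumes "t \<ge> 1"
  shows "\<exists>N::nat. \<forall>ns :: nat list.
     length ns = t \<longrightarrow> (\<forall>i<t. ns ! i \<ge> N) \<longrightarrow>
     (let te = card {i. i < t \<and> even (ns ! i)};
          to = card {i. i < t \<and> odd (ns ! i)};
          c = 82 * (35::real) powr (2 ^ to - 2) * 81 ^ te;
          n = Max (set ns)
      in (\<forall>i<t. real (ns ! i) \<ge> 2 * real_of_int \<lceil>log 2 (real n * c)\<rceil> + 2) \<longrightarrow>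
         real (size_ramsey_cycles ns) \<le> (ln c + 1) * c ^ 2 * real n)"
proof (intro exI[of _ "2 ^ (2 * 2 ^ t + 9)"] allI impI)
  fix ns :: "nat list"
  assume ns: "length ns = t" "\<forall>i<t. 2 ^ (2 * 2 ^ t + 9) \<le> ns ! i"
  then have "ns \<noteq> []" using assms by auto
  with cycles_vertex_factor_le[OF this] ns
  show "let te = card {i. i < t \<and> even (ns ! i)};
          to = card {i. i < t \<and> odd (ns ! i)};
          c = 82 * (35::real) powr (2 ^ to - 2) * 81 ^ te;
          n = Max (set ns)
      in (\<forall>i<t. real (ns ! i) \<ge> 2 * real_of_int \<lceil>log 2 (real n * c)\<rceil> + 2) \<longrightarrow>
         real (size_ramsey_cycles ns) \<le> (ln c + 1) * c ^ 2 * real n"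
    unfolding Let_def using size_ramsey_cycles_upper_bound by blast
qed

end
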